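(* Let $(M,g)$ be the Robinson–Trautman spacetime with coordinates $(t,r,x,y)$, constants $a,b,d\in\mathbb R$ and function $f=f(x,y)$, and let $F_1=f_x^2+f_y^2-f(f_{xx}+f_{yy})$. If $F_1-2a+4br\neq0$ and $rF_1-2ar+6d\neq0$ on $M$, then the spacetime admits generalized conharmonic inheritance with respect to $\xi=\frac{\partial}{\partial x}$, namely $$\mathscr L_\xi K=\lambda_K K+\lambda_1\,g\wedge g+\lambda_2\,g\wedge S,$$ where $$\lambda_K=\frac{F_5}{f(-6d+2ar-rF_1)},\qquad \lambda_2=\frac{4(-d+2br^2)f_x}{rf(F_1-2a+4br)},$$ $$\lambda_1=\frac{16b(-d+2br^2)f_x}{r^2f(F_1-2a+4br)}-\frac{(-d+2br^2)F_5}{r^3f(-6d+2ar-rF_1)},$$ $$F_5=(12d-4ar)f_x+2rf_y^2f_x-rff_{yy}f_x+2rf_x^3-2rff_yf_{xy}+rf^2f_{xyy}-3rff_xf_{xx}+rf^2f_{xxx}.$$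
   Context: Robinson–Trautman (RT) spacetime: $a,b,d\in\mathbb R$ are constants; $M=I\times J\times\Omega$ with coordinates $(x^1,x^2,x^3,x^4)=(t,r,x,y)$, where $I\subset\mathbb R$ and $J\subset\mathbb R\setminus\{0\}$ are open intervals and $\Omega\subset\mathbb R^2$ is open, connected and nonempty; $f:\Omega\to\mathbb R$ is smooth and nowhere vanishing, with subscripts denoting partial derivatives; the metric is $$g=-2\Big(a-2br-\frac dr\Big)dt^2+2\,dt\,dr-\frac{r^2}{f^2}(dx^2+dy^2).$$ ($2\,dt\,dr$ means $g_{12}=g_{21}=1$.) Curvature conventions: with $\Gamma$ the Levi-Civita connection coefficients, $R_{pqrs}=g_{p\alpha}(\partial_r\Gamma^\alpha_{qs}-\partial_s\Gamma^\alpha_{qr}+\Gamma^\beta_{qs}\Gamma^\alpha_{\beta r}-\Gamma^\beta_{qr}\Gamma^\alpha_{\beta s})$ and $S_{qr}=g^{ps}R_{pqrs}$. With this convention $R_{1212}=-\frac{2d}{r^3}$, $S_{12}=-\frac{4b}{r}$, $S_{33}=S_{44}=\frac{F_1-2a+8br}{f^2}$. The Kulkarni–Nomizu product of symmetric $(0,2)$ tensors is $(\phi\wedge\psi)_{pqrs}=\phi_{ps}\psi_{qr}-\phi_{pr}\psi_{qs}+\phi_{qr}\psi_{ps}-\phi_{qs}\psi_{pr}$. The conharmonic $(0,4)$ curvature tensor (dimension 4) is $K=R-\frac12\,S\wedge g$. Generalized conharmonic inheritance with respect to $\xi$ means $\mathscr L_\xi K=\lambda K+\lambda_1 g\wedge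 g+\lambda_2 g\wedge S$ for smooth functions $\lambda,\lambda_1,\lambda_2$, where $\mathscr L_\xi$ is the Lie derivative of the $(0,4)$ tensor. *)

theory Defs
  imports "HOL-Analysis.Analysis"
begin

definition partial_deriv :: "'n::finite \<Rightarrow> (real^'n \<Rightarrow> real) \<Rightarrow> real^'n \<Rightarrow> real" where
  "partial_deriv i F p = deriv (\<lambda>h. F (p + h *\<^sub>R axis i 1)) 0"

text \<open>On an open set this is the usual class of k times continuously differentiable functions.\<close>

fun Ck_on :: "nat \<Rightarrow> (real^'n::finite \<Rightarrow> real) \<Rightarrow> (real^'n) set \<Rightarrow> bool" where
  "Ck_on 0 F U \<longleftrightarrow> continuous_on U F"
| "Ck_on (Suc k) F U \<longleftrightarrow>
     (\<forall>p\<in>U. F differentiable (at p)) \<and> (\<forall>i. Ck_on k (partial_deriv i F) U)"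

definition smooth_on :: "(real^'n::finite \<Rightarrow> real) \<Rightarrow> (real^'n) set \<Rightarrow> bool" where
  "smooth_on F U \<longleftrightarrow> (\<forall>k. Ck_on k F U)"

text \<open>
  Tensor fields on a coordinate domain are given by their component arrays at each point.
  The first index of \<open>christoffel\<close> is the contravariant one.
\<close>

definition christoffel :: "(real^'n::finite \<Rightarrow> real^'n^'n) \<Rightarrow> real^'n \<Rightarrow> real^'n^'n^'n" where
  "christoffel g x = (\<chi> k i j. 1/2 * (\<Sum>l\<in>UNIV. matrix_inv (g x) $ k $ l *
      (partial_deriv i (\<lambda>y. g y $ j $ l) x
     + partial_deriv j (\<lambda>y. g y $ i $ l) x
     - partial_deriv l (\<lambda>y. g y $ i $ j) x)))"

definition riemann :: "(real^'n::finite \<Rightarrow> real^'n^'n) \<Rightarrow> real^'n \<Rightarrow> real^'n^'n^'n^'n" where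
  "riemann g x = (\<chi> p q r s. \<Sum>\<alpha>\<in>UNIV. g x $ p $ \<alpha> *
      (partial_deriv r (\<lambda>y. christoffel g y $ \<alpha> $ q $ s) x
     - partial_deriv s (\<lambda>y. christoffel g y $ \<alpha> $ q $ r) x
     + (\<Sum>\<beta>\<in>UNIV. christoffel g x $ \<beta> $ q $ s * christoffel g x $ \<alpha> $ \<beta> $ r)
     - (\<Sum>\<beta>\<in>UNIV. christoffel g x $ \<beta> $ q $ r * christoffel g x $ \<alpha> $ \<beta> $ s)))"

definition ricci :: "(real^'n::finite \<Rightarrow> real^'n^'n) \<Rightarrow> real^'n \<Rightarrow> real^'n^'n" where
  "ricci g x = (\<chi> q r. \<Sum>p\<in>UNIV. \<Sum>s\<in>UNIV. matrix_inv (g x) $ p $ s * riemann g x $ p $ q $ r $ s)"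

definition kulkarni_nomizu :: "real^'n::finite^'n \<Rightarrow> real^'n^'n \<Rightarrow> real^'n^'n^'n^'n" where
  "kulkarni_nomizu \<phi> \<psi> = (\<chi> p q r s.
      \<phi> $ p $ s * \<psi> $ q $ r - \<phi> $ p $ r * \<psi> $ q $ s
    + \<phi> $ q $ r * \<psi> $ p $ s - \<phi> $ q $ s * \<psi> $ p $ r)"

text \<open>The factor 1/2 is 1/(n - 2) in dimension n = 4.\<close>

definition conharmonic :: "(real^4 \<Rightarrow> real^4^4) \<Rightarrow> real^4 \<Rightarrow> real^4^4^4^4" where
  "conharmonic g x = riemann g x - (1/2) *\<^sub>R kulkarni_nomizu (ricci g x) (g x)"

definition lie_deriv ::
  "(real^'n::finite \<Rightarrow> real^'n) \<Rightarrow> (real^'n \<Rightarrow> real^'n^'n^'n^'n) \<Rightarrow> real^'n \<Rightarrow> real^'n^'n^'n^'n" where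
  "lie_deriv \<xi> T x = (\<chi> p q r s. \<Sum>m\<in>UNIV.
      \<xi> x $ m * partial_deriv m (\<lambda>y. T y $ p $ q $ r $ s) x
    + T x $ m $ q $ r $ s * partial_deriv p (\<lambda>y. \<xi> y $ m) x
    + T x $ p $ m $ r $ s * partial_deriv q (\<lambda>y. \<xi> y $ m) x
    + T x $ p $ q $ m $ s * partial_deriv r (\<lambda>y. \<xi> y $ m) x
    + T x $ p $ q $ r $ m * partial_deriv s (\<lambda>y. \<xi> y $ m) x)"

definition generalized_conharmonic_inheritance ::
  "(real^4) set \<Rightarrow> (real^4 \<Rightarrow> real^4^4) \<Rightarrow> (real^4 \<Rightarrow> real^4)
     \<Rightarrow> (real^4 \<Rightarrow> real) \<Rightarrow> (real^4 \<Rightarrow> real) \<Rightarrow> (real^4 \<Rightarrow> real) \<Rightarrow> bool" where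
  "generalized_conharmonic_inheritance M g \<xi> \<mu> \<mu>\<^sub>1 \<mu>\<^sub>2 \<longleftrightarrow>
     smooth_on \<mu> M \<and> smooth_on \<mu>\<^sub>1 M \<and> smooth_on \<mu>\<^sub>2 M \<and>
     (\<forall>x\<in>M. lie_deriv \<xi> (conharmonic g) x =
         \<mu> x *\<^sub>R conharmonic g x
       + \<mu>\<^sub>1 x *\<^sub>R kulkarni_nomizu (g x) (g x)
       + \<mu>\<^sub>2 x *\<^sub>R kulkarni_nomizu (g x) (ricci g x))"

text \<open>
  A point of the Robinson-Trautman spacetime is \<open>p = (t, r, x, y)\<close>, with \<open>t = p $ 1\<close>,
  \<open>r = p $ 2\<close>, \<open>x = p $ 3\<close> and \<open>y = p $ 4\<close>; \<open>f\<close> is a function of \<open>(x, y)\<close> only.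
\<close>

definition xy_part :: "real^4 \<Rightarrow> real^2" where
  "xy_part p = vector [p $ 3, p $ 4]"

definition rt_domain :: "real set \<Rightarrow> real set \<Rightarrow> (real^2) set \<Rightarrow> (real^4) set" where
  "rt_domain I J \<Omega> = {p. p $ 1 \<in> I \<and> p $ 2 \<in> J \<and> xy_part p \<in> \<Omega>}"

definition rt_metric :: "real \<Rightarrow> real \<Rightarrow> real \<Rightarrow> (real^2 \<Rightarrow> real) \<Rightarrow> real^4 \<Rightarrow> real^4^4" where
  "rt_metric a b d f p =
     (let r = p $ 2; w = - (r\<^sup>2 / (f (xy_part p))\<^sup>2) in
      vector [vector [- 2 * (a - 2 * b * r - d / r), 1, 0, 0],
              vector [1, 0, 0, 0],
              vector [0, 0, w, 0],
              vector [0, 0, 0, w]])"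

text \<open>In \<open>F\<^sub>1\<close> and \<open>F\<^sub>5\<close> the subscripts of \<open>f\<close> are read left to right, so \<open>f\<^sub>x\<^sub>y = \<partial>\<^sub>y (\<partial>\<^sub>x f)\<close>.\<close>

definition rt_F1 :: "(real^2 \<Rightarrow> real) \<Rightarrow> real^4 \<Rightarrow> real" where
  "rt_F1 f p =
     (let q = xy_part p;
          fx = partial_deriv 1 f q;
          fy = partial_deriv 2 f q;
          fxx = partial_deriv 1 (partial_deriv 1 f) q;
          fyy = partial_deriv 2 (partial_deriv 2 f) q
      in fx\<^sup>2 + fy\<^sup>2 - f q * (fxx + fyy))"

definition rt_F5 :: "real \<Rightarrow> real \<Rightarrow> (real^2 \<Rightarrow> real) \<Rightarrow> real^4 \<Rightarrow> real" where
  "rt_F5 a d f p =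
     (let r = p $ 2;
          q = xy_part p;
          F = f q;
          fx = partial_deriv 1 f q;
          fy = partial_deriv 2 f q;
          fxx = partial_deriv 1 (partial_deriv 1 f) q;
          fxy = partial_deriv 2 (partial_deriv 1 f) q;
          fyy = partial_deriv 2 (partial_deriv 2 f) q;
          fxxx = partial_deriv 1 (partial_deriv 1 (partial_deriv 1 f)) q;
          fxyy = partial_deriv 2 (partial_deriv 2 (partial_deriv 1 f)) q
      in (12 * d - 4 * a * r) * fx + 2 * r * fy\<^sup>2 * fx - r * F * fyy * fx + 2 * r * fx ^ 3
         - 2 * r * F * fy * fxy + r * F\<^sup>2 * fxyy - 3 * r * F * fx * fxx + r * F\<^sup>2 * fxxx)"

end

theory Submission
  imports Defs
begin

text \<open>
  The Robinson-Trautman metric is a warped product: \<open>g = h + k\<close>, where \<open>h\<close> is a metric on the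
  \<open>(t, r)\<close>-plane that depends on \<open>r\<close> only, and \<open>k = - (r\<^sup>2 / f\<^sup>2) (dx\<^sup>2 + dy\<^sup>2)\<close> lives on the
  \<open>(x, y)\<close>-surface. Base and fibre are two-dimensional and the Hessian of the warping
  function \<open>r\<close> is proportional to \<open>h\<close>, so the curvature at a point amounts to three scalars, the
  sectional curvatures \<open>K\<^sub>b\<close>, \<open>K\<^sub>m\<close>, \<open>K\<^sub>f\<close> of the base plane, the mixed planes and the fibre plane:
  \<open>R\<close> is a combination of \<open>h \<and> h\<close>, \<open>h \<and> k\<close> and \<open>k \<and> k\<close> (\<open>riemann_eq\<close>). By bilinearity of the
  Kulkarni-Nomizu product the same is true of everything that enters the claim:
  \<open>S = \<alpha> h + \<beta> k\<close> with \<open>\<alpha> = - K\<^sub>b - 2 K\<^sub>m\<close> and \<open>\<beta> = - 2 K\<^sub>m - K\<^sub>f\<close> (\<open>ricci_eq\<close>), and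
  \<open>K = A (h \<and> h) + B (h \<and> k) + A (k \<and> k)\<close> with \<open>A = K\<^sub>m\<close> and \<open>B = K\<^sub>m + (K\<^sub>b + K\<^sub>f) / 2\<close>
  (\<open>conharmonic_eq\<close>).

  The field \<open>\<partial>/\<partial>x\<close> has constant components, so its Lie derivative differentiates components in
  the direction \<open>x\<close>. There \<open>h\<close> and \<open>A\<close> are constant, \<open>\<partial>\<^sub>x k = \<sigma> k\<close> with \<open>\<sigma> = - 2 f\<^sub>x / f\<close>,
  and \<open>B\<close> changes only through \<open>F\<^sub>1\<close>. The inheritance equation is therefore a linear system of
  three equations, one for each of \<open>h \<and> h\<close>, \<open>h \<and> k\<close>, \<open>k \<and> k\<close> (\<open>inheritance_combination\<close>):
  \<open>\<lambda> A + \<lambda>\<^sub>1 + \<lambda>\<^sub>2 \<alpha> = 0\<close>,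
  \<open>\<lambda> B + 2 \<lambda>\<^sub>1 + \<lambda>\<^sub>2 (\<alpha> + \<beta>) = \<partial>\<^sub>x B + B \<sigma>\<close> and
  \<open>\<lambda> A + \<lambda>\<^sub>1 + \<lambda>\<^sub>2 \<beta> = 2 A \<sigma>\<close>.
  Subtracting the first from the third determines \<open>\<lambda>\<^sub>2\<close>, because
  \<open>\<beta> - \<alpha> = - (F\<^sub>1 - 2a + 4br) / r\<^sup>2\<close>; subtracting twice the first from the second then determines \<open>\<lambda>\<close>, because
  \<open>B - 2A = (6d - 2ar + rF\<^sub>1) / (2r\<^sup>3)\<close>; the first gives \<open>\<lambda>\<^sub>1\<close>. The two nonvanishing hypotheses
  make these two divisions possible, and \<open>F\<^sub>5\<close> is the numerator that the second one produces (\<open>F5_eq\<close>).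

  Two analytic points remain. The sectional curvatures and \<open>\<partial>\<^sub>x F\<^sub>1\<close> come out in the stated form only
  if partial derivatives of \<open>f\<close> commute (\<open>partial_deriv_commute\<close>), and the coefficients
  must be smooth, which follows from closure of smooth functions under the field operations.
\<close>

section \<open>Calculus of partial derivatives\<close>

text \<open>
  The relational form carries the existence of the derivative, so that derivatives of composite
  fields can be assembled by resolution; \<open>partial_deriv\<close> alone is an arbitrary value where the
  derivative does not exist.
\<close>

definition has_partial_deriv :: "'n::finite \<Rightarrow> (real^'n \<Rightarrow> real) \<Rightarrow> real \<Rightarrow> real^'n \<Rightarrow> bool" where
  "has_partial_deriv i F D p \<longleftrightarrow> ((\<lambda>h. F (p + h *\<^sub>R axis i 1)) has_real_derivative D) (at 0)"

lemma has_partial_deriv_imp_eq: "has_partial_deriv i F D p \<Longrightarrow> partial_deriv i F p = D"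
  unfolding has_partial_deriv_def partial_deriv_def by (rule DERIV_imp_deriv)

lemma has_partial_deriv_eq_rhs: "has_partial_deriv i F D p \<Longrightarrow> D = E \<Longrightarrow> has_partial_deriv i F E p"
  by simp

lemma differentiable_has_partial_deriv:
  assumes "F differentiable (at p)"
  shows "has_partial_deriv i F (partial_deriv i F p) p"
proof -
  from assms obtain F' where F': "(F has_derivative F') (at p)"
    by (auto simp: differentiable_def)
  have line: "((\<lambda>h. p + h *\<^sub>R axis i 1) has_derivative (\<lambda>h. h *\<^sub>R axis i 1)) (at (0::real))"
    by (auto intro!: derivative_eq_intros)
  have F'_at: "(F has_derivative F') (at (p + 0 *\<^sub>R axis i 1))"
    using F' by simp
  have "((\<lambda>h. F (p + h *\<^sub>R axis i 1)) has_derivative (\<lambda>h. F' (h *\<^sub>R axis i 1))) (at 0)"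
    using diff_chain_at[OF line F'_at] by (simp add: o_def)
  moreover have "F' (h *\<^sub>R axis i 1) = F' (axis i 1) * h" for h
    using has_derivative_linear[OF F'] by (simp add: linear_cmul)
  ultimately have "has_partial_deriv i F (F' (axis i 1)) p"
    by (simp add: has_partial_deriv_def has_field_derivative_def)
  then show ?thesis
    by (simp add: has_partial_deriv_imp_eq)
qed

lemma has_partial_deriv_along_line:
  assumes "has_partial_deriv i F D (p + s *\<^sub>R axis i 1)"
  shows "((\<lambda>s. F (p + s *\<^sub>R axis i 1)) has_real_derivative D) (at s)"
  using assms DERIV_shift[of "\<lambda>s. F (p + s *\<^sub>R axis i 1)" D 0 s]
  by (simp add: has_partial_deriv_def algebra_simps)

text \<open>
  The closed forms of the connection coefficients are known on the coordinate domain only.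
  That is enough to differentiate them, since the domain is open.
\<close>

lemma has_partial_deriv_cong_open:
  assumes "open U" "p \<in> U" "\<And>q. q \<in> U \<Longrightarrow> F q = G q"
  shows "has_partial_deriv i F D p \<longleftrightarrow> has_partial_deriv i G D p"
proof -
  let ?l = "\<lambda>h::real. p + h *\<^sub>R axis i 1"
  have "open (?l -` U)"
    by (intro open_vimage assms(1) continuous_intros)
  then have "eventually (\<lambda>h. h \<in> ?l -` U) (nhds 0)"
    using assms(2) by (intro eventually_nhds_in_open) auto
  then have "eventually (\<lambda>h. F (?l h) = G (?l h)) (nhds 0)"
    by eventually_elim (use assms(3) in auto)
  then show ?thesis
    unfolding has_partial_deriv_def by (intro DERIV_cong_ev) auto
qed

lemma partial_deriv_cong_open:
  assumes "open U" "p \<in> U" "\<And>q. q \<in> U \<Longrightarrow> F q = G q"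
  shows "partial_deriv i F p = partial_deriv i G p"
proof -
  have "has_partial_deriv i F D p \<longleftrightarrow> has_partial_deriv i G D p" for D
    by (rule has_partial_deriv_cong_open[OF assms])
  then show ?thesis
    unfolding partial_deriv_def has_partial_deriv_def deriv_def by simp
qed

lemma has_partial_deriv_const: "has_partial_deriv i (\<lambda>_. c) 0 p"
  by (simp add: has_partial_deriv_def)

lemma has_partial_deriv_coord:
  "has_partial_deriv i (\<lambda>q. q $ j) (if i = j then 1 else 0) p"
  unfolding has_partial_deriv_def
  by (auto intro!: derivative_eq_intros simp: axis_def)

lemma has_partial_deriv_add:
  "has_partial_deriv i F D p \<Longrightarrow> has_partial_deriv i G E p
    \<Longrightarrow> has_partial_deriv i (\<lambda>q. F q + G q) (D + E) p"
  unfolding has_partial_deriv_def by (rule DERIV_add)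

lemma has_partial_deriv_diff:
  "has_partial_deriv i F D p \<Longrightarrow> has_partial_deriv i G E p
    \<Longrightarrow> has_partial_deriv i (\<lambda>q. F q - G q) (D - E) p"
  unfolding has_partial_deriv_def by (rule DERIV_diff)

lemma has_partial_deriv_minus:
  "has_partial_deriv i F D p \<Longrightarrow> has_partial_deriv i (\<lambda>q. - F q) (- D) p"
  unfolding has_partial_deriv_def by (rule DERIV_minus)

lemma has_partial_deriv_mult:
  "has_partial_deriv i F D p \<Longrightarrow> has_partial_deriv i G E p
    \<Longrightarrow> has_partial_deriv i (\<lambda>q. F q * G q) (D * G p + E * F p) p"
  unfolding has_partial_deriv_def by (drule (1) DERIV_mult) simp

lemma has_partial_deriv_inverse:
  "has_partial_deriv i F D p \<Longrightarrow> F p \<noteq> 0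
    \<Longrightarrow> has_partial_deriv i (\<lambda>q. inverse (F q)) (- (D * (inverse (F p) * inverse (F p)))) p"
  unfolding has_partial_deriv_def
  by (drule DERIV_inverse_fun) (auto simp: power2_eq_square)

lemma has_partial_deriv_divide:
  "has_partial_deriv i F D p \<Longrightarrow> has_partial_deriv i G E p \<Longrightarrow> G p \<noteq> 0
    \<Longrightarrow> has_partial_deriv i (\<lambda>q. F q / G q) ((D * G p - F p * E) / (G p * G p)) p"
  unfolding has_partial_deriv_def by (drule (1) DERIV_divide) auto

lemma has_partial_deriv_power:
  "has_partial_deriv i F D p
    \<Longrightarrow> has_partial_deriv i (\<lambda>q. F q ^ n) (of_nat n * (D * F p ^ (n - 1))) p"
  unfolding has_partial_deriv_def by (drule DERIV_power[of _ _ _ _ n]) auto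

lemmas has_partial_deriv_intros =
  has_partial_deriv_const has_partial_deriv_coord has_partial_deriv_add has_partial_deriv_diff
  has_partial_deriv_minus has_partial_deriv_mult has_partial_deriv_divide has_partial_deriv_power

section \<open>Closure properties of smooth functions\<close>

lemma Ck_on_cong_open:
  assumes "open U" "\<And>q. q \<in> U \<Longrightarrow> F q = G q"
  shows "Ck_on k F U \<longleftrightarrow> Ck_on k G U"
  using assms(2)
proof (induction k arbitrary: F G)
  case 0
  then show ?case by (simp cong: continuous_on_cong)
next
  case (Suc k)
  have imp: "F2 differentiable (at p)"
    if "F1 differentiable (at p)" "p \<in> U" "\<And>q. q \<in> U \<Longrightarrow> F1 q = F2 q"
    for F1 F2 :: "real^'a \<Rightarrow> real" and p
    using that assms(1) has_derivative_transform_within_open[of F1 _ p UNIV U F2]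
    by (auto simp: differentiable_def)
  have "Ck_on k (partial_deriv i F) U \<longleftrightarrow> Ck_on k (partial_deriv i G) U" for i
    by (intro Suc.IH partial_deriv_cong_open[OF assms(1)] Suc.prems)
  moreover have "F differentiable (at p) \<longleftrightarrow> G differentiable (at p)" if "p \<in> U" for p
    using imp[of F p G] imp[of G p F] Suc.prems that by metis
  ultimately show ?case by simp
qed

lemma Ck_on_SucD: "Ck_on (Suc k) F U \<Longrightarrow> Ck_on k F U"
proof (induction k arbitrary: F)
  case 0
  then have "isCont F p" if "p \<in> U" for p
    using that by (simp add: differentiable_imp_continuous_within)
  then show ?case
    by (simp add: continuous_at_imp_continuous_on)
next
  case (Suc k)
  from Suc.prems have "\<forall>p\<in>U. F differentiable (at p)" "Ck_on (Suc k) (partial_deriv i F) U" for i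
    by (blast dest: Ck_on.simps(2)[THEN iffD1])+
  then show ?case
    using Suc.IH[of "partial_deriv i F" for i] by (simp only: Ck_on.simps(2)[of k]) blast
qed

text \<open>
  The closure properties below go by induction on the order: it suffices to know the first partial
  derivatives on the set and to see that they are again built by the operations in question.
\<close>

lemma Ck_on_SucI:
  assumes "open U" "\<And>p. p \<in> U \<Longrightarrow> F differentiable (at p)"
    and "\<And>i p. p \<in> U \<Longrightarrow> partial_deriv i F p = D i p" "\<And>i. Ck_on k (D i) U"
  shows "Ck_on (Suc k) F U"
proof -
  have "Ck_on k (partial_deriv i F) U" for i
    by (rule iffD2[OF Ck_on_cong_open[OF assms(1,3)] assms(4)])
  with assms(2) show ?thesis
    unfolding Ck_on.simps by blast
qed

lemma Ck_on_const: "open U \<Longrightarrow> Ck_on k (\<lambda>_. c) U"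
proof (induction k arbitrary: c)
  case (Suc k)
  show ?case
    by (rule Ck_on_SucI[where D = "\<lambda>_ _. 0"])
      (auto simp: Suc has_partial_deriv_imp_eq[OF has_partial_deriv_const])
qed simp

lemma Ck_on_coord:
  assumes "open U"
  shows "Ck_on k (\<lambda>q. q $ j) U"
proof (cases k)
  case 0
  then show ?thesis
    by (simp add: linear_continuous_on bounded_linear_vec_nth)
next
  case (Suc l)
  show ?thesis unfolding Suc
    by (rule Ck_on_SucI[OF assms, where D = "\<lambda>i _. if i = j then 1 else 0"])
      (auto simp: Ck_on_const[OF assms] has_partial_deriv_imp_eq[OF has_partial_deriv_coord]
        bounded_linear_imp_differentiable bounded_linear_vec_nth)
qed

lemma Ck_on_add:
  assumes "open U" "Ck_on k F U" "Ck_on k G U"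
  shows "Ck_on k (\<lambda>q. F q + G q) U"
  using assms(2,3)
proof (induction k arbitrary: F G)
  case 0
  then show ?case by (simp add: continuous_on_add)
next
  case (Suc k)
  show ?case
  proof (rule Ck_on_SucI[OF assms(1)])
    show "partial_deriv i (\<lambda>q. F q + G q) p = partial_deriv i F p + partial_deriv i G p"
      if "p \<in> U" for i p
      using Suc.prems that
      by (intro has_partial_deriv_imp_eq has_partial_deriv_add differentiable_has_partial_deriv) auto
  qed (use Suc in \<open>auto simp: differentiable_add\<close>)
qed

lemma Ck_on_mult:
  assumes "open U" "Ck_on k F U" "Ck_on k G U"
  shows "Ck_on k (\<lambda>q. F q * G q) U"
  using assms(2,3)
proof (induction k arbitrary: F G)
  case 0
  then show ?case by (simp add: continuous_on_mult)
next
  case (Suc k)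
  show ?case
  proof (rule Ck_on_SucI[OF assms(1)])
    show "partial_deriv i (\<lambda>q. F q * G q) p = partial_deriv i F p * G p + partial_deriv i G p * F p"
      if "p \<in> U" for i p
      using Suc.prems that
      by (intro has_partial_deriv_imp_eq has_partial_deriv_mult differentiable_has_partial_deriv) auto
    show "Ck_on k (\<lambda>p. partial_deriv i F p * G p + partial_deriv i G p * F p) U" for i
      using Suc.prems Suc.prems[THEN Ck_on_SucD]
      by (intro Ck_on_add[OF assms(1)] Suc.IH) simp_all
  qed (use Suc in \<open>auto simp: differentiable_mult\<close>)
qed

lemma Ck_on_inverse:
  assumes "open U" "Ck_on k F U" "\<And>q. q \<in> U \<Longrightarrow> F q \<noteq> 0"
  shows "Ck_on k (\<lambda>q. inverse (F q)) U"
  using assms(2)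
proof (induction k)
  case 0
  with assms(3) show ?case by (simp add: continuous_on_inverse)
next
  case (Suc k)
  let ?D = "\<lambda>i q. (- 1) * (partial_deriv i F q * (inverse (F q) * inverse (F q)))"
  show ?case
  proof (rule Ck_on_SucI[OF assms(1)])
    show "partial_deriv i (\<lambda>q. inverse (F q)) p = ?D i p" if "p \<in> U" for i p
    proof -
      have "F differentiable (at p)" "F p \<noteq> 0"
        using Suc.prems that assms(3) by auto
      then show ?thesis
        by (simp add: has_partial_deriv_imp_eq[OF has_partial_deriv_inverse]
            differentiable_has_partial_deriv)
    qed
    show "Ck_on k (?D i) U" for i
      using Suc.prems Ck_on_SucD[OF Suc.prems] Suc.IH assms(1)
      by (intro Ck_on_mult Ck_on_const) simp_all
  qed (use Suc assms(3) in \<open>auto simp: differentiable_inverse\<close>)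
qed

lemma smooth_on_const: "open U \<Longrightarrow> smooth_on (\<lambda>_. c) U"
  by (simp add: smooth_on_def Ck_on_const)

lemma smooth_on_coord: "open U \<Longrightarrow> smooth_on (\<lambda>q. q $ j) U"
  by (simp add: smooth_on_def Ck_on_coord)

lemma smooth_on_add:
  "open U \<Longrightarrow> smooth_on F U \<Longrightarrow> smooth_on G U \<Longrightarrow> smooth_on (\<lambda>q. F q + G q) U"
  by (simp add: smooth_on_def Ck_on_add)

lemma smooth_on_mult:
  "open U \<Longrightarrow> smooth_on F U \<Longrightarrow> smooth_on G U \<Longrightarrow> smooth_on (\<lambda>q. F q * G q) U"
  by (simp add: smooth_on_def Ck_on_mult)

lemma smooth_on_minus: "open U \<Longrightarrow> smooth_on F U \<Longrightarrow> smooth_on (\<lambda>q. - F q) U"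
  using smooth_on_mult[OF _ smooth_on_const[of U "-1"], of F] by simp

lemma smooth_on_diff:
  "open U \<Longrightarrow> smooth_on F U \<Longrightarrow> smooth_on G U \<Longrightarrow> smooth_on (\<lambda>q. F q - G q) U"
  using smooth_on_add[OF _ _ smooth_on_minus, of U F G] by simp

lemma smooth_on_divide:
  "open U \<Longrightarrow> smooth_on F U \<Longrightarrow> smooth_on G U \<Longrightarrow> \<forall>q\<in>U. G q \<noteq> 0
    \<Longrightarrow> smooth_on (\<lambda>q. F q / G q) U"
  using smooth_on_mult[of U F "\<lambda>q. inverse (G q)"]
  by (simp add: smooth_on_def Ck_on_inverse divide_inverse)

lemma smooth_on_power: "open U \<Longrightarrow> smooth_on F U \<Longrightarrow> smooth_on (\<lambda>q. F q ^ n) U"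
  by (induction n) (auto intro: smooth_on_const smooth_on_mult)

lemma smooth_on_partial_deriv: "smooth_on F U \<Longrightarrow> smooth_on (partial_deriv i F) U"
  unfolding smooth_on_def by (metis Ck_on.simps(2))

lemmas smooth_on_intros =
  smooth_on_const smooth_on_coord smooth_on_add smooth_on_diff smooth_on_minus smooth_on_mult
  smooth_on_power

lemma smooth_on_imp_differentiable: "smooth_on F U \<Longrightarrow> p \<in> U \<Longrightarrow> F differentiable (at p)"
  unfolding smooth_on_def by (metis Ck_on.simps(2))

lemma smooth_on_imp_continuous_on: "smooth_on F U \<Longrightarrow> continuous_on U F"
  unfolding smooth_on_def by (metis Ck_on.simps(1))

section \<open>Symmetry of mixed partial derivatives\<close>

text \<open>
  The mean value theorem, first in direction \<open>i\<close> and then in direction \<open>j\<close>, turns the second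
  difference of \<open>F\<close> over a square into a mixed second derivative at an inner point. The second
  difference is symmetric in the two directions, which is why mixed derivatives commute.
\<close>

lemma double_difference_mean_value:
  fixes F :: "real^'n::finite \<Rightarrow> real"
  assumes "h > 0"
    and square: "\<And>s t. 0 \<le> s \<Longrightarrow> s \<le> h \<Longrightarrow> 0 \<le> t \<Longrightarrow> t \<le> h
                  \<Longrightarrow> p + s *\<^sub>R axis i 1 + t *\<^sub>R axis j 1 \<in> U"
    and diff: "\<And>q. q \<in> U \<Longrightarrow> F differentiable (at q)"
              "\<And>q. q \<in> U \<Longrightarrow> partial_deriv i F differentiable (at q)"
  obtains s t where "0 < s" "s < h" "0 < t" "t < h"
    "F (p + h *\<^sub>R axis i 1 + h *\<^sub>R axis j 1) - F (p + h *\<^sub>R axis i 1) - F (p + h *\<^sub>R axis j 1) + F p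
      = h * (h * partial_deriv j (partial_deriv i F) (p + s *\<^sub>R axis i 1 + t *\<^sub>R axis j 1))"
proof -
  let ?e = "axis i 1 :: real^'n" and ?e' = "axis j 1 :: real^'n"
  define \<phi> where "\<phi> = (\<lambda>s. F (p + h *\<^sub>R ?e' + s *\<^sub>R ?e) - F (p + s *\<^sub>R ?e))"
  have "(\<phi> has_real_derivative
      partial_deriv i F (p + h *\<^sub>R ?e' + s *\<^sub>R ?e) - partial_deriv i F (p + s *\<^sub>R ?e)) (at s)"
    if "0 \<le> s" "s \<le> h" for s
  proof -
    have eq: "p + h *\<^sub>R ?e' + s *\<^sub>R ?e = p + s *\<^sub>R ?e + h *\<^sub>R ?e'"
      by (simp only: ac_simps)
    have "p + h *\<^sub>R ?e' + s *\<^sub>R ?e \<in> U" "p + s *\<^sub>R ?e \<in> U"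
      unfolding eq using square[of s h] square[of s 0] that \<open>h > 0\<close> by simp_all
    then show ?thesis
      unfolding \<phi>_def
      by (intro DERIV_diff has_partial_deriv_along_line[where F = F]
          differentiable_has_partial_deriv diff(1))
  qed
  from MVT2[OF \<open>h > 0\<close> this] obtain s where s: "0 < s" "s < h"
    and \<phi>: "\<phi> h - \<phi> 0 =
      (h - 0) * (partial_deriv i F (p + h *\<^sub>R ?e' + s *\<^sub>R ?e) - partial_deriv i F (p + s *\<^sub>R ?e))"
    by blast
  define \<psi> where "\<psi> = (\<lambda>t. partial_deriv i F (p + s *\<^sub>R ?e + t *\<^sub>R ?e'))"
  have "(\<psi> has_real_derivative partial_deriv j (partial_deriv i F) (p + s *\<^sub>R ?e + t *\<^sub>R ?e')) (at t)"
    if "0 \<le> t" "t \<le> h" for t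
    unfolding \<psi>_def using square[of s t] s that
    by (intro has_partial_deriv_along_line[where F = "partial_deriv i F"]
        differentiable_has_partial_deriv diff(2)) auto
  from MVT2[OF \<open>h > 0\<close> this] obtain t where t: "0 < t" "t < h"
    and \<psi>: "\<psi> h - \<psi> 0 = (h - 0) * partial_deriv j (partial_deriv i F) (p + s *\<^sub>R ?e + t *\<^sub>R ?e')"
    by blast
  show thesis
    using that[OF s t] \<phi> \<psi> by (simp add: \<phi>_def \<psi>_def ac_simps)
qed

lemma partial_deriv_commute:
  assumes U: "open U" "p \<in> U" and F: "smooth_on F U"
  shows "partial_deriv j (partial_deriv i F) p = partial_deriv i (partial_deriv j F) p"
proof (rule ccontr)
  let ?A = "partial_deriv j (partial_deriv i F)" and ?B = "partial_deriv i (partial_deriv j F)"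
  assume neq: "?A p \<noteq> ?B p"
  define \<epsilon> where "\<epsilon> = \<bar>?A p - ?B p\<bar> / 2"
  have \<epsilon>: "\<epsilon> > 0" using neq by (simp add: \<epsilon>_def)
  have cont: "continuous_on U ?A" "continuous_on U ?B"
    using F by (auto intro: smooth_on_partial_deriv smooth_on_imp_continuous_on)
  then have "(?A \<longlongrightarrow> ?A p) (nhds p)" "(?B \<longlongrightarrow> ?B p) (nhds p)"
    using U by (simp_all add: continuous_on_eq_continuous_at isCont_def tendsto_at_iff_tendsto_nhds)
  then have "eventually (\<lambda>q. dist (?A q) (?A p) < \<epsilon>) (nhds p)"
            "eventually (\<lambda>q. dist (?B q) (?B p) < \<epsilon>) (nhds p)"
    using \<epsilon> by (auto dest: tendstoD)
  moreover have "eventually (\<lambda>q. q \<in> U) (nhds p)"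
    using U by (rule eventually_nhds_in_open)
  ultimately have "eventually (\<lambda>q. q \<in> U \<and> dist (?A q) (?A p) < \<epsilon> \<and> dist (?B q) (?B p) < \<epsilon>) (nhds p)"
    by eventually_elim auto
  then obtain \<delta> where "\<delta> > 0"
    and \<delta>: "\<And>q. dist q p < \<delta> \<Longrightarrow> q \<in> U \<and> dist (?A q) (?A p) < \<epsilon> \<and> dist (?B q) (?B p) < \<epsilon>"
    by (auto simp: eventually_nhds_metric)
  \<comment> \<open>A square of this side with corner \<open>p\<close> stays within distance \<open>2h < \<delta>\<close> of \<open>p\<close>.\<close>
  define h where "h = \<delta> / 3"
  have "h > 0" using \<open>\<delta> > 0\<close> by (simp add: h_def)
  have near: "dist (p + s *\<^sub>R axis k 1 + t *\<^sub>R axis l 1) p < \<delta>"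
    if "0 \<le> s" "s \<le> h" "0 \<le> t" "t \<le> h" for s t and k l :: 'a
  proof -
    have "dist (p + s *\<^sub>R axis k 1 + t *\<^sub>R axis l 1) p \<le> norm (s *\<^sub>R axis k (1::real)) + norm (t *\<^sub>R axis l (1::real))"
      using norm_triangle_ineq[of "s *\<^sub>R axis k (1::real)" "t *\<^sub>R axis l (1::real)"]
      by (simp add: dist_norm add.assoc)
    also have "\<dots> \<le> h + h"
      using that by simp
    finally show ?thesis
      using \<open>\<delta> > 0\<close> by (simp add: h_def)
  qed
  have diff: "F differentiable (at q)" "partial_deriv k F differentiable (at q)" if "q \<in> U" for q k
    using F that by (auto intro: smooth_on_imp_differentiable smooth_on_partial_deriv)
  let ?pt = "\<lambda>k s l t. p + s *\<^sub>R axis k 1 + t *\<^sub>R axis l 1"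
  let ?\<Delta> = "F (?pt i h j h) - F (p + h *\<^sub>R axis i 1) - F (p + h *\<^sub>R axis j 1) + F p"
  obtain s t where st: "0 < s" "s < h" "0 < t" "t < h" "?\<Delta> = h * (h * ?A (?pt i s j t))"
    by (rule double_difference_mean_value[OF \<open>h > 0\<close>, of p i j U F]) (use \<delta> near diff in auto)
  obtain s' t' where st': "0 < s'" "s' < h" "0 < t'" "t' < h"
      "F (?pt j h i h) - F (p + h *\<^sub>R axis j 1) - F (p + h *\<^sub>R axis i 1) + F p = h * (h * ?B (?pt j s' i t'))"
    by (rule double_difference_mean_value[OF \<open>h > 0\<close>, of p j i U F]) (use \<delta> near diff in auto)
  have "?pt j h i h = ?pt i h j h" by simp
  then have "h * (h * ?A (?pt i s j t)) = h * (h * ?B (?pt j s' i t'))"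
    using st(5) st'(5) by (metis (no_types, opaque_lifting) diff_diff_eq add.commute)
  then have "?A (?pt i s j t) = ?B (?pt j s' i t')"
    using \<open>h > 0\<close> by simp
  moreover have "dist (?A (?pt i s j t)) (?A p) < \<epsilon>" "dist (?B (?pt j s' i t')) (?B p) < \<epsilon>"
    using \<delta> near st st' by auto
  ultimately have "dist (?A p) (?B p) < \<epsilon> + \<epsilon>"
    using dist_triangle2[of "?A p" "?B p" "?A (?pt i s j t)"] by (simp add: dist_commute)
  then show False
    by (simp add: \<epsilon>_def dist_real_def)
qed

section \<open>Algebra and calculus of tensor components\<close>

lemma vector_4:
  "(vector [w, x, y, z] :: 'a::zero^4) $ 1 = w"
  "(vector [w, x, y, z] :: 'a::zero^4) $ 2 = x"
  "(vector [w, x, y, z] :: 'a::zero^4) $ 3 = y"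
  "(vector [w, x, y, z] :: 'a::zero^4) $ 4 = z"
  unfolding vector_def by simp_all

lemma matrix_inv_eq:
  fixes A :: "'a::semiring_1^'n^'m"
  assumes "A ** B = mat 1" "B ** A = mat 1"
  shows "matrix_inv A = B"
proof -
  have "A ** matrix_inv A = mat 1 \<and> matrix_inv A ** A = mat 1"
    unfolding matrix_inv_def by (rule someI[where x = B]) (use assms in blast)
  then have "matrix_inv A = (B ** A) ** matrix_inv A" "A ** matrix_inv A = mat 1"
    using assms(2) by (simp_all add: matrix_mul_lid)
  then show ?thesis
    by (simp add: matrix_mul_assoc[symmetric] matrix_mul_rid)
qed

lemma kulkarni_nomizu_commute: "kulkarni_nomizu \<phi> \<psi> = kulkarni_nomizu \<psi> \<phi>"
  by (simp add: kulkarni_nomizu_def vec_eq_iff algebra_simps)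

lemma kulkarni_nomizu_add_right:
  "kulkarni_nomizu \<phi> (\<psi> + \<omega>) = kulkarni_nomizu \<phi> \<psi> + kulkarni_nomizu \<phi> \<omega>"
  by (simp add: kulkarni_nomizu_def vec_eq_iff algebra_simps)

lemma kulkarni_nomizu_add_left:
  "kulkarni_nomizu (\<phi> + \<psi>) \<omega> = kulkarni_nomizu \<phi> \<omega> + kulkarni_nomizu \<psi> \<omega>"
  by (simp add: kulkarni_nomizu_def vec_eq_iff algebra_simps)

lemma kulkarni_nomizu_scaleR_right:
  "kulkarni_nomizu \<phi> (c *\<^sub>R \<psi>) = c *\<^sub>R kulkarni_nomizu \<phi> \<psi>"
  by (simp add: kulkarni_nomizu_def vec_eq_iff algebra_simps)

lemma kulkarni_nomizu_scaleR_left: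
  "kulkarni_nomizu (c *\<^sub>R \<phi>) \<psi> = c *\<^sub>R kulkarni_nomizu \<phi> \<psi>"
  by (simp add: kulkarni_nomizu_def vec_eq_iff algebra_simps)

lemmas kulkarni_nomizu_bilinear =
  kulkarni_nomizu_add_left kulkarni_nomizu_add_right
  kulkarni_nomizu_scaleR_left kulkarni_nomizu_scaleR_right

lemma kulkarni_nomizu_nth:
  "kulkarni_nomizu \<phi> \<psi> $ i $ j $ m $ n =
    \<phi> $ i $ n * \<psi> $ j $ m - \<phi> $ i $ m * \<psi> $ j $ n
    + \<phi> $ j $ m * \<psi> $ i $ n - \<phi> $ j $ n * \<psi> $ i $ m"
  by (simp add: kulkarni_nomizu_def)

text \<open>
  The Leibniz rule for the bilinear Kulkarni-Nomizu product.
\<close>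

lemma has_partial_deriv_kulkarni_nomizu:
  assumes "\<And>i j. has_partial_deriv l (\<lambda>q. \<phi> q $ i $ j) (\<phi>' $ i $ j) p"
    and "\<And>i j. has_partial_deriv l (\<lambda>q. \<psi> q $ i $ j) (\<psi>' $ i $ j) p"
  shows "has_partial_deriv l (\<lambda>q. kulkarni_nomizu (\<phi> q) (\<psi> q) $ i $ j $ m $ n)
    ((kulkarni_nomizu \<phi>' (\<psi> p) + kulkarni_nomizu (\<phi> p) \<psi>') $ i $ j $ m $ n) p"
  unfolding kulkarni_nomizu_nth vector_add_component
  apply (rule has_partial_deriv_eq_rhs)
   apply (rule has_partial_deriv_add has_partial_deriv_diff has_partial_deriv_mult assms)+
  apply (simp add: algebra_simps)
  done

text \<open>
  The components of a coordinate field are constant, so the terms of the Lie derivative that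
  differentiate the field vanish.
\<close>

lemma lie_deriv_coordinate_field:
  "lie_deriv (\<lambda>_. axis l 1) T p $ i $ j $ m $ n = partial_deriv l (\<lambda>q. T q $ i $ j $ m $ n) p"
proof -
  have "partial_deriv s (\<lambda>_. axis l 1 $ c :: real) p = 0" for s c
    by (rule has_partial_deriv_imp_eq[OF has_partial_deriv_const])
  then show ?thesis
    by (simp add: lie_deriv_def axis_def if_distrib[of "\<lambda>x. x * _"] cong: if_cong)
qed

section \<open>Warped products of a plane and a conformally flat surface\<close>

text \<open>
  Instances of this lemma turn the tables below into rewrite rules for single entries. Unfolding a
  whole table at each of the several thousand places where an entry is read would be far too costly.
\<close>

lemma nth_of_vector_4:
  fixes v :: "'a::zero^4"
  assumes "v = vector [w, x, y, z]"
  shows "v $ 1 = w" "v $ 2 = x" "v $ 3 = y" "v $ 4 = z"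
  by (simp_all add: assms vector_4)

text \<open>
  The block shape shared by the metric, its base and fibre parts \<open>h = metric_table u 1 0\<close> and
  \<open>k = metric_table 0 0 w\<close>, and the partial derivatives of the metric.
\<close>

definition metric_table :: "real \<Rightarrow> real \<Rightarrow> real \<Rightarrow> real^4^4" where
  "metric_table u v w = vector
    [vector [u, v, 0, 0], vector [v, 0, 0, 0], vector [0, 0, w, 0], vector [0, 0, 0, w]]"

definition inverse_metric_table :: "real \<Rightarrow> real \<Rightarrow> real^4^4" where
  "inverse_metric_table u w = vector
    [vector [0, 1, 0, 0], vector [1, - u, 0, 0], vector [0, 0, 1 / w, 0], vector [0, 0, 0, 1 / w]]"

lemmas metric_table_rows =
  nth_of_vector_4[OF metric_table_def] nth_of_vector_4[OF inverse_metric_table_def]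
lemmas metric_table_entries =
  metric_table_rows[THEN nth_of_vector_4(1)] metric_table_rows[THEN nth_of_vector_4(2)]
  metric_table_rows[THEN nth_of_vector_4(3)] metric_table_rows[THEN nth_of_vector_4(4)]

text \<open>
  The shape of the connection coefficients \<open>\<Gamma>\<close> of the metric, contravariant index first. It is linear
  in its seven independent entries, so the partial derivatives of \<open>\<Gamma>\<close> have the same shape, with the
  differentiated entries.
\<close>

definition christoffel_table ::
  "real \<Rightarrow> real \<Rightarrow> real \<Rightarrow> real \<Rightarrow> real \<Rightarrow> real \<Rightarrow> real \<Rightarrow> real^4^4^4" where
  "christoffel_table A B C D E X Y = vector
    [vector [vector [- A, 0, 0, 0], vector [0, 0, 0, 0], vector [0, 0, C, 0], vector [0, 0, 0, C]],
     vector [vector [B, A, 0, 0], vector [A, 0, 0, 0], vector [0, 0, - D, 0], vector [0, 0, 0, - D]],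
     vector [vector [0, 0, 0, 0], vector [0, 0, E, 0], vector [0, E, - X, - Y], vector [0, 0, - Y, X]],
     vector [vector [0, 0, 0, 0], vector [0, 0, 0, E], vector [0, 0, Y, - X], vector [0, E, - X, - Y]]]"

lemmas christoffel_table_planes = nth_of_vector_4[OF christoffel_table_def]
lemmas christoffel_table_rows =
  christoffel_table_planes[THEN nth_of_vector_4(1)] christoffel_table_planes[THEN nth_of_vector_4(2)]
  christoffel_table_planes[THEN nth_of_vector_4(3)] christoffel_table_planes[THEN nth_of_vector_4(4)]
lemmas christoffel_table_entries =
  christoffel_table_rows[THEN nth_of_vector_4(1)] christoffel_table_rows[THEN nth_of_vector_4(2)]
  christoffel_table_rows[THEN nth_of_vector_4(3)] christoffel_table_rows[THEN nth_of_vector_4(4)]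

lemma metric_table_combination:
  "x *\<^sub>R metric_table u v w + y *\<^sub>R metric_table u' v' w' =
    metric_table (x * u + y * u') (x * v + y * v') (x * w + y * w')"
  by (simp add: vec_eq_iff forall_4 metric_table_entries)

lemma matrix_inv_metric_table:
  assumes "w \<noteq> 0"
  shows "matrix_inv (metric_table u 1 w) = inverse_metric_table u w"
  by (rule matrix_inv_eq)
    (simp_all add: vec_eq_iff forall_4 matrix_matrix_mult_def sum_4 mat_def metric_table_entries assms)

lemma has_partial_deriv_metric_table:
  assumes "has_partial_deriv i U U' p" "has_partial_deriv i V V' p" "has_partial_deriv i W W' p"
  shows "has_partial_deriv i (\<lambda>q. metric_table (U q) (V q) (W q) $ j $ k)
    (metric_table U' V' W' $ j $ k) p"
proof -
  have "\<forall>j k. has_partial_deriv i (\<lambda>q. metric_table (U q) (V q) (W q) $ j $ k)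
      (metric_table U' V' W' $ j $ k) p"
    unfolding forall_4 by (simp add: metric_table_entries assms has_partial_deriv_const)
  then show ?thesis by blast
qed

lemma has_partial_deriv_christoffel_table:
  assumes "has_partial_deriv i A A' p" "has_partial_deriv i B B' p" "has_partial_deriv i C C' p"
    "has_partial_deriv i D D' p" "has_partial_deriv i E E' p" "has_partial_deriv i X X' p"
    "has_partial_deriv i Y Y' p"
  shows "has_partial_deriv i
    (\<lambda>q. christoffel_table (A q) (B q) (C q) (D q) (E q) (X q) (Y q) $ l $ j $ k)
    (christoffel_table A' B' C' D' E' X' Y' $ l $ j $ k) p"
proof -
  have "\<forall>l j k. has_partial_deriv i
      (\<lambda>q. christoffel_table (A q) (B q) (C q) (D q) (E q) (X q) (Y q) $ l $ j $ k)
      (christoffel_table A' B' C' D' E' X' Y' $ l $ j $ k) p"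
    unfolding forall_4
    by (simp add: christoffel_table_entries assms has_partial_deriv_const has_partial_deriv_minus)
  then show ?thesis by blast
qed

text \<open>
  Here \<open>G1\<close> stands for the radial derivative of \<open>G = g\<^sub>1\<^sub>1\<close>, and \<open>dg i\<close> for the derivative of the
  metric in direction \<open>i\<close>; the base does not depend on \<open>x, y\<close>, and nothing depends on \<open>t\<close>.
\<close>

lemma christoffel_of_metric_table:
  fixes w r G G1 F Fx Fy :: real
  assumes "r \<noteq> 0" "F \<noteq> 0" "w = - (r\<^sup>2 / F\<^sup>2)"
  defines "dg \<equiv> \<lambda>i. metric_table (vector [0, G1, 0, 0] $ (i::4)) 0
      (vector [0, - (2 * r / F\<^sup>2), 2 * r\<^sup>2 * Fx / F ^ 3, 2 * r\<^sup>2 * Fy / F ^ 3] $ i)"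
  shows "1/2 * (\<Sum>l\<in>UNIV. inverse_metric_table G w $ k $ l *
      (dg i $ j $ l + dg j $ i $ l - dg l $ i $ j)) =
    christoffel_table (G1 / 2) (G * G1 / 2) (r / F\<^sup>2) (G * r / F\<^sup>2) (1 / r) (Fx / F) (Fy / F) $ k $ i $ j"
proof -
  define P where "P k i j \<longleftrightarrow> 1/2 * (\<Sum>l\<in>UNIV. inverse_metric_table G w $ k $ l *
      (dg i $ j $ l + dg j $ i $ l - dg l $ i $ j)) =
    christoffel_table (G1 / 2) (G * G1 / 2) (r / F\<^sup>2) (G * r / F\<^sup>2) (1 / r) (Fx / F) (Fy / F) $ k $ i $ j" for k i j
  have "\<forall>k i j. P k i j"
    unfolding forall_4 P_def dg_def sum_4
    by (simp add: metric_table_entries christoffel_table_entries vector_4)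
      (simp add: assms field_simps power2_eq_square power3_eq_cube)
  then show ?thesis by (simp add: P_def)
qed

text \<open>
  The curvature of the warped product, for an arbitrary radial function \<open>G = g\<^sub>1\<^sub>1\<close> with derivatives
  \<open>G1\<close> and \<open>G2\<close>. The variables \<open>Ar\<close>, \<open>Cx\<close> and so on are the derivatives of the entries \<open>A\<close>, \<open>C\<close> and so on in the
  directions \<open>r\<close>, \<open>x\<close>, \<open>y\<close>. That \<open>Xy\<close> and \<open>Yx\<close> involve the same \<open>Fxy\<close> is the symmetry of second
  derivatives; without it \<open>R\<close> would have a component \<open>R\<^sub>3\<^sub>3\<^sub>3\<^sub>4\<close>.
  All entries are variables constrained by equations: most of the 256 components already
  collapse by cancellation among opaque variables, and only the others need arithmetic with
  fractions.
\<close>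

lemma riemann_of_christoffel_table:
  fixes i j m n :: 4 and G G1 G2 r F Fx Fy Fxx Fxy Fyy w :: real
    and A B C D E X Y Ar Br Cr Cx Cy Dr Dx Dy Er Xx Xy Yx Yy K\<^sub>b K\<^sub>m K\<^sub>f :: real
  assumes nz: "r \<noteq> 0" "F \<noteq> 0"
    and entries: "A = G1 / 2" "B = G * G1 / 2" "C = r / F\<^sup>2" "D = G * r / F\<^sup>2"
      "E = 1 / r" "X = Fx / F" "Y = Fy / F"
    and derivs: "Ar = G2 / 2" "Br = (G1 * G1 + G * G2) / 2"
      "Cr = 1 / F\<^sup>2" "Cx = - (2 * r * Fx / F ^ 3)" "Cy = - (2 * r * Fy / F ^ 3)"
      "Dr = (G1 * r + G) / F\<^sup>2" "Dx = - (2 * G * r * Fx / F ^ 3)" "Dy = - (2 * G * r * Fy / F ^ 3)"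
      "Er = - (1 / r\<^sup>2)"
      "Xx = (Fxx * F - Fx * Fx) / F\<^sup>2" "Xy = (Fxy * F - Fx * Fy) / F\<^sup>2"
      "Yx = (Fxy * F - Fy * Fx) / F\<^sup>2" "Yy = (Fyy * F - Fy * Fy) / F\<^sup>2"
    and w: "w = - (r\<^sup>2 / F\<^sup>2)"
    and sectional: "K\<^sub>b = G2 / 2" "K\<^sub>m = G1 / (2 * r)" "K\<^sub>f = (Fx\<^sup>2 + Fy\<^sup>2 - F * (Fxx + Fyy) + G) / r\<^sup>2"
  defines "T \<equiv> christoffel_table A B C D E X Y"
    and "dT \<equiv> \<lambda>l. christoffel_table (vector [0, Ar, 0, 0] $ (l::4)) (vector [0, Br, 0, 0] $ l)
      (vector [0, Cr, Cx, Cy] $ l) (vector [0, Dr, Dx, Dy] $ l) (vector [0, Er, 0, 0] $ l)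
      (vector [0, 0, Xx, Xy] $ l) (vector [0, 0, Yx, Yy] $ l)"
    and "h \<equiv> metric_table G 1 0" and "k \<equiv> metric_table 0 0 w"
  shows "(\<Sum>\<alpha>\<in>UNIV. metric_table G 1 w $ i $ \<alpha> * (dT m $ \<alpha> $ j $ n - dT n $ \<alpha> $ j $ m
      + (\<Sum>\<beta>\<in>UNIV. T $ \<beta> $ j $ n * T $ \<alpha> $ \<beta> $ m)
      - (\<Sum>\<beta>\<in>UNIV. T $ \<beta> $ j $ m * T $ \<alpha> $ \<beta> $ n)))
    = (- (K\<^sub>b / 2) *\<^sub>R kulkarni_nomizu h h - K\<^sub>m *\<^sub>R kulkarni_nomizu h k
        - (K\<^sub>f / 2) *\<^sub>R kulkarni_nomizu k k) $ i $ j $ m $ n"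
proof -
  define P where "P i j m n \<longleftrightarrow>
    (\<Sum>\<alpha>\<in>UNIV. metric_table G 1 w $ i $ \<alpha> * (dT m $ \<alpha> $ j $ n - dT n $ \<alpha> $ j $ m
      + (\<Sum>\<beta>\<in>UNIV. T $ \<beta> $ j $ n * T $ \<alpha> $ \<beta> $ m)
      - (\<Sum>\<beta>\<in>UNIV. T $ \<beta> $ j $ m * T $ \<alpha> $ \<beta> $ n)))
    = (- (K\<^sub>b / 2) *\<^sub>R kulkarni_nomizu h h - K\<^sub>m *\<^sub>R kulkarni_nomizu h k
        - (K\<^sub>f / 2) *\<^sub>R kulkarni_nomizu k k) $ i $ j $ m $ n" for i j m n
  have "\<forall>i j m n. P i j m n"
    unfolding forall_4
    apply (intro conjI)
    \<comment> \<open>Looking up the entries already closes most components.\<close>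
    apply (simp_all add: P_def T_def dT_def h_def k_def metric_table_entries
        kulkarni_nomizu_nth christoffel_table_entries vector_4 sum_4)
    apply (simp_all add: entries derivs w sectional nz)
    apply (simp_all add: field_simps nz power2_eq_square power3_eq_cube power4_eq_xxxx)
    done
  then show ?thesis by (simp add: P_def)
qed

text \<open>
  Tracing over \<open>p, s\<close> meets each sectional curvature once for every plane through a given direction: a
  base direction lies in one base plane and two mixed planes, a fibre direction in two mixed planes
  and one fibre plane. The sign is negative because the trace is taken over the first and last index.
\<close>

lemma ricci_of_warped_riemann:
  fixes G w K\<^sub>b K\<^sub>m K\<^sub>f :: real
  assumes "w \<noteq> 0"
  defines "h \<equiv> metric_table G 1 0" and "k \<equiv> metric_table 0 0 w"
  defines "R \<equiv> - (K\<^sub>b / 2) *\<^sub>R kulkarni_nomizu h h - K\<^sub>m *\<^sub>R kulkarni_nomizu h k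
      - (K\<^sub>f / 2) *\<^sub>R kulkarni_nomizu k k"
  shows "(\<Sum>p\<in>UNIV. \<Sum>s\<in>UNIV. inverse_metric_table G w $ p $ s * R $ p $ q $ r $ s) =
    ((- K\<^sub>b - 2 * K\<^sub>m) *\<^sub>R h + (- 2 * K\<^sub>m - K\<^sub>f) *\<^sub>R k) $ q $ r"
proof -
  define P where "P q r \<longleftrightarrow> (\<Sum>p\<in>UNIV. \<Sum>s\<in>UNIV. inverse_metric_table G w $ p $ s * R $ p $ q $ r $ s) =
    ((- K\<^sub>b - 2 * K\<^sub>m) *\<^sub>R h + (- 2 * K\<^sub>m - K\<^sub>f) *\<^sub>R k) $ q $ r" for q r
  have "\<forall>q r. P q r"
    unfolding forall_4 P_def sum_4 R_def h_def k_def
    by (simp add: metric_table_entries kulkarni_nomizu_nth) (simp add: assms(1) field_simps)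
  then show ?thesis by (simp add: P_def)
qed

text \<open>
  The coefficients of \<open>h \<and> h\<close> and of \<open>k \<and> k\<close> agree because subtracting the Ricci part cancels
  \<open>K\<^sub>b\<close> from the first and \<open>K\<^sub>f\<close> from the second.
\<close>

lemma conharmonic_of_warped_ricci:
  fixes h k :: "real^'n::finite^'n" and K\<^sub>b K\<^sub>m K\<^sub>f :: real
  defines "R \<equiv> - (K\<^sub>b / 2) *\<^sub>R kulkarni_nomizu h h - K\<^sub>m *\<^sub>R kulkarni_nomizu h k
      - (K\<^sub>f / 2) *\<^sub>R kulkarni_nomizu k k"
    and "S \<equiv> (- K\<^sub>b - 2 * K\<^sub>m) *\<^sub>R h + (- 2 * K\<^sub>m - K\<^sub>f) *\<^sub>R k"
  shows "R - (1/2) *\<^sub>R kulkarni_nomizu S (h + k) =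
    K\<^sub>m *\<^sub>R kulkarni_nomizu h h + (K\<^sub>m + (K\<^sub>b + K\<^sub>f) / 2) *\<^sub>R kulkarni_nomizu h k
      + K\<^sub>m *\<^sub>R kulkarni_nomizu k k"
  unfolding R_def S_def kulkarni_nomizu_bilinear kulkarni_nomizu_commute[of k h]
  by (simp add: vec_eq_iff field_simps)

text \<open>
  Comparing coefficients reduces inheritance to three scalar equations; \<open>x\<close> and \<open>y\<close> are the
  coefficients of the Lie derivative, which has no \<open>h \<and> h\<close> part.
\<close>

lemma inheritance_combination:
  fixes h k S :: "real^'n::finite^'n"
  assumes "\<mu> * A + \<mu>\<^sub>1 + \<mu>\<^sub>2 * \<alpha> = 0"
    and "\<mu> * B + 2 * \<mu>\<^sub>1 + \<mu>\<^sub>2 * (\<alpha> + \<beta>) = x"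
    and "\<mu> * A + \<mu>\<^sub>1 + \<mu>\<^sub>2 * \<beta> = y"
  shows "x *\<^sub>R kulkarni_nomizu h k + y *\<^sub>R kulkarni_nomizu k k =
    \<mu> *\<^sub>R (A *\<^sub>R kulkarni_nomizu h h + B *\<^sub>R kulkarni_nomizu h k + A *\<^sub>R kulkarni_nomizu k k)
    + \<mu>\<^sub>1 *\<^sub>R kulkarni_nomizu (h + k) (h + k)
    + \<mu>\<^sub>2 *\<^sub>R kulkarni_nomizu (h + k) (\<alpha> *\<^sub>R h + \<beta> *\<^sub>R k)"
proof -
  have "\<mu> *\<^sub>R (A *\<^sub>R kulkarni_nomizu h h + B *\<^sub>R kulkarni_nomizu h k + A *\<^sub>R kulkarni_nomizu k k)
      + \<mu>\<^sub>1 *\<^sub>R kulkarni_nomizu (h + k) (h + k)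
      + \<mu>\<^sub>2 *\<^sub>R kulkarni_nomizu (h + k) (\<alpha> *\<^sub>R h + \<beta> *\<^sub>R k) =
    (\<mu> * A + \<mu>\<^sub>1 + \<mu>\<^sub>2 * \<alpha>) *\<^sub>R kulkarni_nomizu h h
    + (\<mu> * B + 2 * \<mu>\<^sub>1 + \<mu>\<^sub>2 * (\<alpha> + \<beta>)) *\<^sub>R kulkarni_nomizu h k
    + (\<mu> * A + \<mu>\<^sub>1 + \<mu>\<^sub>2 * \<beta>) *\<^sub>R kulkarni_nomizu k k"
    unfolding kulkarni_nomizu_bilinear kulkarni_nomizu_commute[of k h]
    by (simp add: vec_eq_iff algebra_simps)
  with assms show ?thesis by simp
qed

section \<open>Fields on the Robinson-Trautman domain\<close>

lemma xy_part_translate: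
  "xy_part (p + t *\<^sub>R axis 1 1) = xy_part p"
  "xy_part (p + t *\<^sub>R axis 2 1) = xy_part p"
  "xy_part (p + t *\<^sub>R axis 3 1) = xy_part p + t *\<^sub>R axis 1 1"
  "xy_part (p + t *\<^sub>R axis 4 1) = xy_part p + t *\<^sub>R axis 2 1"
  by (simp_all add: xy_part_def vec_eq_iff forall_2 axis_def)

lemma bounded_linear_xy_part: "bounded_linear xy_part"
  unfolding linear_conv_bounded_linear[symmetric]
  by (rule linearI) (simp_all add: xy_part_def vec_eq_iff forall_2)

text \<open>
  A function of \<open>(x, y)\<close> only: its derivatives along \<open>t\<close> and \<open>r\<close> vanish.
\<close>

lemma has_partial_deriv_xy_part:
  assumes "u differentiable (at (xy_part p))"
  shows "has_partial_deriv i (\<lambda>q. u (xy_part q))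
    (vector [0, 0, partial_deriv 1 u (xy_part p), partial_deriv 2 u (xy_part p)] $ i) p"
proof -
  have "has_partial_deriv 1 u (partial_deriv 1 u (xy_part p)) (xy_part p)"
       "has_partial_deriv 2 u (partial_deriv 2 u (xy_part p)) (xy_part p)"
    using assms by (rule differentiable_has_partial_deriv)+
  then show ?thesis
    using exhaust_4[of i]
    by (auto simp: has_partial_deriv_def xy_part_translate vector_4)
qed

lemma open_rt_domain:
  assumes "open I" "open J" "open \<Omega>"
  shows "open (rt_domain I J \<Omega>)"
proof -
  have "rt_domain I J \<Omega> = (\<lambda>p. p $ 1) -` I \<inter> ((\<lambda>p. p $ 2) -` J \<inter> xy_part -` \<Omega>)"
    by (auto simp: rt_domain_def)
  moreover have "continuous_on UNIV xy_part"
    by (rule linear_continuous_on[OF bounded_linear_xy_part])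
  ultimately show ?thesis
    using assms
    by (auto intro!: open_Int open_vimage linear_continuous_on bounded_linear_vec_nth)
qed

lemma Ck_on_xy_part:
  assumes "open U" "\<And>p. p \<in> U \<Longrightarrow> xy_part p \<in> \<Omega>" "Ck_on k u \<Omega>"
  shows "Ck_on k (\<lambda>p. u (xy_part p)) U"
  using assms(3)
proof (induction k arbitrary: u)
  case 0
  have "continuous_on U xy_part"
    by (rule linear_continuous_on[OF bounded_linear_xy_part])
  with 0 show ?case
    using assms(2) by (auto intro: continuous_on_compose2)
next
  case (Suc k)
  have diff: "u differentiable (at (xy_part p))" if "p \<in> U" for p
    using Suc.prems assms(2) that by simp
  let ?D = "\<lambda>i p. vector [0, 0, partial_deriv 1 u (xy_part p), partial_deriv 2 u (xy_part p)] $ (i::4)"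
  show ?case
  proof (rule Ck_on_SucI[OF assms(1), where D = ?D])
    fix p assume "p \<in> U"
    then show "(\<lambda>q. u (xy_part q)) differentiable (at p)"
      using differentiable_chain_at[of xy_part p u] diff
      by (simp add: o_def bounded_linear_imp_differentiable bounded_linear_xy_part)
    fix i show "partial_deriv i (\<lambda>q. u (xy_part q)) p = ?D i p"
      by (rule has_partial_deriv_imp_eq[OF has_partial_deriv_xy_part[OF diff[OF \<open>p \<in> U\<close>]]])
  next
    have "Ck_on k (\<lambda>p. partial_deriv j u (xy_part p)) U" for j
      using Suc.prems by (intro Suc.IH) simp
    moreover have "Ck_on k (\<lambda>_. 0) U"
      by (rule Ck_on_const[OF assms(1)])
    ultimately show "Ck_on k (?D i) U" for i
      using exhaust_4[of i] by (auto simp: vector_4)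
  qed
qed

lemma smooth_on_xy_part:
  "open U \<Longrightarrow> (\<And>p. p \<in> U \<Longrightarrow> xy_part p \<in> \<Omega>) \<Longrightarrow> smooth_on u \<Omega>
    \<Longrightarrow> smooth_on (\<lambda>p. u (xy_part p)) U"
  using Ck_on_xy_part unfolding smooth_on_def by blast

section \<open>Curvature of the Robinson-Trautman metric\<close>

locale robinson_trautman =
  fixes a b d :: real and I J :: "real set" and \<Omega> :: "(real^2) set" and f :: "real^2 \<Rightarrow> real"
  assumes open_I: "open I" and open_J: "open J" and J_nonzero: "0 \<notin> J" and open_\<Omega>: "open \<Omega>"
    and smooth_f: "smooth_on f \<Omega>" and f_nonzero: "\<forall>q\<in>\<Omega>. f q \<noteq> 0"
begin

abbreviation "M \<equiv> rt_domain I J \<Omega>"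
abbreviation "g \<equiv> rt_metric a b d f"

abbreviation "F p \<equiv> f (xy_part p)"
abbreviation "Fx p \<equiv> partial_deriv 1 f (xy_part p)"
abbreviation "Fy p \<equiv> partial_deriv 2 f (xy_part p)"
abbreviation "Fxx p \<equiv> partial_deriv 1 (partial_deriv 1 f) (xy_part p)"
abbreviation "Fxy p \<equiv> partial_deriv 2 (partial_deriv 1 f) (xy_part p)"
abbreviation "Fyy p \<equiv> partial_deriv 2 (partial_deriv 2 f) (xy_part p)"

text \<open>
  The component \<open>g\<^sub>1\<^sub>1\<close> and its first and second derivatives along \<open>r\<close>.
\<close>

definition gtt :: "real^4 \<Rightarrow> real" where "gtt p = - 2 * (a - 2 * b * p $ 2 - d / p $ 2)"
definition gtt' :: "real^4 \<Rightarrow> real" where "gtt' p = 4 * b - 2 * d / (p $ 2)\<^sup>2"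
definition gtt'' :: "real^4 \<Rightarrow> real" where "gtt'' p = 4 * d / (p $ 2) ^ 3"
definition warp :: "real^4 \<Rightarrow> real" where "warp p = - ((p $ 2)\<^sup>2 / (F p)\<^sup>2)"

lemma open_M: "open M"
  by (rule open_rt_domain[OF open_I open_J open_\<Omega>])

lemma in_M:
  assumes "p \<in> M"
  shows "p $ 2 \<noteq> 0" "xy_part p \<in> \<Omega>" "F p \<noteq> 0" "warp p \<noteq> 0"
  using assms J_nonzero f_nonzero by (auto simp: rt_domain_def warp_def)

lemma metric_eq: "g p = metric_table (gtt p) 1 (warp p)"
  by (simp add: rt_metric_def metric_table_def gtt_def warp_def Let_def)

lemma metric_split: "g p = metric_table (gtt p) 1 0 + metric_table 0 0 (warp p)"
  using metric_table_combination[of 1 "gtt p" 1 0 1 0 0 "warp p"] by (simp add: metric_eq)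

lemma inverse_metric_eq: "p \<in> M \<Longrightarrow> matrix_inv (g p) = inverse_metric_table (gtt p) (warp p)"
  by (simp add: metric_eq matrix_inv_metric_table in_M)

lemma has_partial_deriv_radius:
  "has_partial_deriv i (\<lambda>q. q $ 2) (vector [0, 1, 0, 0] $ i) (p :: real^4)"
  using exhaust_4[of i] has_partial_deriv_coord[of i 2 p] by (auto simp: vector_4)

lemma has_partial_deriv_lift:
  assumes "p \<in> M" "smooth_on u \<Omega>"
  shows "has_partial_deriv i (\<lambda>q. u (xy_part q))
    (vector [0, 0, partial_deriv 1 u (xy_part p), partial_deriv 2 u (xy_part p)] $ i) p"
  using assms in_M by (intro has_partial_deriv_xy_part smooth_on_imp_differentiable)

lemmas smooth_f_partials =
  smooth_f smooth_f[THEN smooth_on_partial_deriv] smooth_f[THEN smooth_on_partial_deriv, THEN smooth_on_partial_deriv]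

lemma has_partial_deriv_gtt:
  assumes "p \<in> M"
  shows "has_partial_deriv i gtt (vector [0, gtt' p, 0, 0] $ i) p"
    and "has_partial_deriv i gtt' (vector [0, gtt'' p, 0, 0] $ i) p"
proof -
  show "has_partial_deriv i gtt (vector [0, gtt' p, 0, 0] $ i) p"
    unfolding gtt_def
    apply (rule has_partial_deriv_eq_rhs)
     apply (rule has_partial_deriv_intros has_partial_deriv_radius in_M(1)[OF assms])+
    using exhaust_4[of i] in_M[OF assms]
    apply (auto simp: vector_4 gtt'_def field_simps power2_eq_square)
    done
  show "has_partial_deriv i gtt' (vector [0, gtt'' p, 0, 0] $ i) p"
    unfolding gtt'_def
    apply (rule has_partial_deriv_eq_rhs)
     apply (rule has_partial_deriv_intros has_partial_deriv_radius in_M(1)[OF assms])+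
    using exhaust_4[of i] in_M[OF assms]
    apply (auto simp: vector_4 gtt''_def field_simps power2_eq_square power3_eq_cube power4_eq_xxxx)
    done
qed

lemma has_partial_deriv_warp:
  assumes "p \<in> M"
  shows "has_partial_deriv i warp
    (vector [0, - (2 * p $ 2 / (F p)\<^sup>2), 2 * (p $ 2)\<^sup>2 * Fx p / F p ^ 3,
             2 * (p $ 2)\<^sup>2 * Fy p / F p ^ 3] $ i) p"
  unfolding warp_def
  apply (rule has_partial_deriv_eq_rhs)
   apply (rule has_partial_deriv_intros has_partial_deriv_lift[OF assms smooth_f] | simp add: in_M[OF assms])+
  using exhaust_4[of i] in_M[OF assms]
  apply (auto simp: vector_4 field_simps power2_eq_square power3_eq_cube power4_eq_xxxx)
  done

lemma christoffel_eq:
  assumes "p \<in> M"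
  shows "christoffel g p = christoffel_table (gtt' p / 2) (gtt p * gtt' p / 2) (p $ 2 / (F p)\<^sup>2)
    (gtt p * p $ 2 / (F p)\<^sup>2) (1 / p $ 2) (Fx p / F p) (Fy p / F p)"
proof -
  let ?dg = "\<lambda>i. metric_table (vector [0, gtt' p, 0, 0] $ i) 0
    (vector [0, - (2 * p $ 2 / (F p)\<^sup>2), 2 * (p $ 2)\<^sup>2 * Fx p / F p ^ 3,
             2 * (p $ 2)\<^sup>2 * Fy p / F p ^ 3] $ i)"
  have dg: "partial_deriv i (\<lambda>q. g q $ j $ l) p = ?dg i $ j $ l" for i j l
    unfolding metric_eq
    by (intro has_partial_deriv_imp_eq has_partial_deriv_metric_table has_partial_deriv_const
        has_partial_deriv_gtt(1) has_partial_deriv_warp assms)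
  show ?thesis
    unfolding christoffel_def dg inverse_metric_eq[OF assms] vec_eq_iff vec_lambda_beta
    using christoffel_of_metric_table[OF in_M(1,3)[OF assms] warp_def] by blast
qed

text \<open>
  The coefficients are halves of the sectional curvatures \<open>K\<^sub>b = gtt'' / 2\<close>, \<open>K\<^sub>m = gtt' / (2r)\<close>
  (which counts twice, as \<open>h \<and> k\<close> and \<open>k \<and> h\<close> coincide) and \<open>K\<^sub>f = (F\<^sub>1 + gtt) / r\<^sup>2\<close>, with the sign
  that comes from \<open>(g \<and> g)\<^sub>p\<^sub>q\<^sub>p\<^sub>q = - 2 (g\<^sub>p\<^sub>p g\<^sub>q\<^sub>q - g\<^sub>p\<^sub>q\<^sup>2)\<close>. In \<open>K\<^sub>f\<close>, the term \<open>F\<^sub>1 / r\<^sup>2\<close> is the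
  intrinsic curvature of the fibre metric, and \<open>gtt / r\<^sup>2\<close> its bending by the warping function.
\<close>

lemma riemann_eq:
  assumes "p \<in> M"
  defines "h \<equiv> metric_table (gtt p) 1 0" and "k \<equiv> metric_table 0 0 (warp p)"
  shows "riemann g p = - (gtt'' p / 2 / 2) *\<^sub>R kulkarni_nomizu h h
    - (gtt' p / (2 * p $ 2)) *\<^sub>R kulkarni_nomizu h k
    - ((rt_F1 f p + gtt p) / (p $ 2)\<^sup>2 / 2) *\<^sub>R kulkarni_nomizu k k"
proof -
  have F1: "rt_F1 f p + gtt p = (Fx p)\<^sup>2 + (Fy p)\<^sup>2 - F p * (Fxx p + Fyy p) + gtt p"
    by (simp add: rt_F1_def Let_def)
  have Fyx: "partial_deriv 1 (partial_deriv 2 f) (xy_part p) = Fxy p"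
    using partial_deriv_commute[OF open_\<Omega> in_M(2)[OF assms(1)] smooth_f] .
  note partials = has_partial_deriv_intros has_partial_deriv_gtt[OF assms(1)]
    smooth_f_partials[THEN has_partial_deriv_lift[OF assms(1)]]
  note nz = in_M[OF assms(1)]
  let ?A = "\<lambda>q. gtt' q / 2" and ?B = "\<lambda>q. gtt q * gtt' q / 2"
    and ?C = "\<lambda>q. q $ 2 / (F q)\<^sup>2" and ?D = "\<lambda>q. gtt q * q $ 2 / (F q)\<^sup>2"
    and ?E = "\<lambda>q. 1 / q $ 2" and ?X = "\<lambda>q. Fx q / F q" and ?Y = "\<lambda>q. Fy q / F q"
  let ?Ar = "gtt'' p / 2" and ?Br = "(gtt' p * gtt' p + gtt p * gtt'' p) / 2"
    and ?Cr = "1 / (F p)\<^sup>2" and ?Cx = "- (2 * p $ 2 * Fx p / F p ^ 3)"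
    and ?Cy = "- (2 * p $ 2 * Fy p / F p ^ 3)"
    and ?Dr = "(gtt' p * p $ 2 + gtt p) / (F p)\<^sup>2"
    and ?Dx = "- (2 * gtt p * p $ 2 * Fx p / F p ^ 3)"
    and ?Dy = "- (2 * gtt p * p $ 2 * Fy p / F p ^ 3)"
    and ?Er = "- (1 / (p $ 2)\<^sup>2)"
    and ?Xx = "(Fxx p * F p - Fx p * Fx p) / (F p)\<^sup>2" and ?Xy = "(Fxy p * F p - Fx p * Fy p) / (F p)\<^sup>2"
    and ?Yx = "(Fxy p * F p - Fy p * Fx p) / (F p)\<^sup>2" and ?Yy = "(Fyy p * F p - Fy p * Fy p) / (F p)\<^sup>2"
  have A: "has_partial_deriv m ?A (vector [0, ?Ar, 0, 0] $ m) p" for m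
    apply (rule has_partial_deriv_eq_rhs, (rule partials | simp add: nz)+)
    using exhaust_4[of m] by (auto simp: vector_4)
  have B: "has_partial_deriv m ?B (vector [0, ?Br, 0, 0] $ m) p" for m
    apply (rule has_partial_deriv_eq_rhs, (rule partials | simp add: nz)+)
    using exhaust_4[of m] by (auto simp: vector_4)
  have C: "has_partial_deriv m ?C (vector [0, ?Cr, ?Cx, ?Cy] $ m) p" for m
    apply (rule has_partial_deriv_eq_rhs, (rule partials | simp add: nz)+)
    using exhaust_4[of m] nz by (auto simp: vector_4 field_simps power2_eq_square power3_eq_cube power4_eq_xxxx)
  have D: "has_partial_deriv m ?D (vector [0, ?Dr, ?Dx, ?Dy] $ m) p" for m
    apply (rule has_partial_deriv_eq_rhs, (rule partials | simp add: nz)+)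
    using exhaust_4[of m] nz by (auto simp: vector_4 field_simps power2_eq_square power3_eq_cube power4_eq_xxxx)
  have E: "has_partial_deriv m ?E (vector [0, ?Er, 0, 0] $ m) p" for m
    apply (rule has_partial_deriv_eq_rhs, (rule partials | simp add: nz)+)
    using exhaust_4[of m] nz by (auto simp: vector_4 field_simps power2_eq_square)
  have X: "has_partial_deriv m ?X (vector [0, 0, ?Xx, ?Xy] $ m) p" for m
    apply (rule has_partial_deriv_eq_rhs, (rule partials | simp add: nz)+)
    using exhaust_4[of m] nz by (auto simp: vector_4 field_simps power2_eq_square)
  have Y: "has_partial_deriv m ?Y (vector [0, 0, ?Yx, ?Yy] $ m) p" for m
    apply (rule has_partial_deriv_eq_rhs, (rule partials | simp add: nz)+)
    using exhaust_4[of m] nz by (auto simp: vector_4 Fyx field_simps power2_eq_square)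
  have d\<Gamma>: "partial_deriv m (\<lambda>q. christoffel g q $ \<alpha> $ i $ j) p =
      christoffel_table (vector [0, ?Ar, 0, 0] $ m) (vector [0, ?Br, 0, 0] $ m)
      (vector [0, ?Cr, ?Cx, ?Cy] $ m) (vector [0, ?Dr, ?Dx, ?Dy] $ m) (vector [0, ?Er, 0, 0] $ m)
      (vector [0, 0, ?Xx, ?Xy] $ m) (vector [0, 0, ?Yx, ?Yy] $ m) $ \<alpha> $ i $ j" for m \<alpha> i j
    apply (subst partial_deriv_cong_open[OF open_M assms(1)])
     apply (subst christoffel_eq, assumption, rule refl)
    apply (intro has_partial_deriv_imp_eq has_partial_deriv_christoffel_table A B C D E X Y)
    done
  show ?thesis
    unfolding riemann_def d\<Gamma> christoffel_eq[OF assms(1)] metric_eq vec_eq_iff vec_lambda_beta h_def k_def F1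
    by (intro allI, rule riemann_of_christoffel_table[OF nz(1,3)]) (rule refl warp_def)+
qed

lemma ricci_eq:
  assumes "p \<in> M"
  shows "ricci g p =
    (- (gtt'' p / 2) - 2 * (gtt' p / (2 * p $ 2))) *\<^sub>R metric_table (gtt p) 1 0 +
    (- 2 * (gtt' p / (2 * p $ 2)) - (rt_F1 f p + gtt p) / (p $ 2)\<^sup>2) *\<^sub>R metric_table 0 0 (warp p)"
  unfolding ricci_def inverse_metric_eq[OF assms] riemann_eq[OF assms] vec_eq_iff vec_lambda_beta
  by (intro allI ricci_of_warped_riemann in_M[OF assms])

lemma conharmonic_eq:
  assumes "p \<in> M"
  defines "h \<equiv> metric_table (gtt p) 1 0" and "k \<equiv> metric_table 0 0 (warp p)"
  shows "conharmonic g p = (gtt' p / (2 * p $ 2)) *\<^sub>R kulkarni_nomizu h h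
    + (gtt' p / (2 * p $ 2) + (gtt'' p / 2 + (rt_F1 f p + gtt p) / (p $ 2)\<^sup>2) / 2) *\<^sub>R kulkarni_nomizu h k
    + (gtt' p / (2 * p $ 2)) *\<^sub>R kulkarni_nomizu k k"
  unfolding conharmonic_def riemann_eq[OF assms(1)] ricci_eq[OF assms(1)] metric_split
    h_def[symmetric] k_def[symmetric]
  by (rule conharmonic_of_warped_ricci)

section \<open>Inheritance along the x-direction\<close>

text \<open>
  The derivative of \<open>F\<^sub>1\<close> along \<open>x\<close>, with the mixed derivatives ordered as in \<open>F\<^sub>5\<close>.
\<close>

abbreviation "dF1 p \<equiv> 2 * Fx p * Fxx p + 2 * Fy p * Fxy p - Fx p * (Fxx p + Fyy p)
  - F p * (partial_deriv 1 (partial_deriv 1 (partial_deriv 1 f)) (xy_part p)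
           + partial_deriv 2 (partial_deriv 2 (partial_deriv 1 f)) (xy_part p))"

lemma partial_deriv_fyy_x:
  assumes "q \<in> \<Omega>"
  shows "partial_deriv 1 (partial_deriv 2 (partial_deriv 2 f)) q
    = partial_deriv 2 (partial_deriv 2 (partial_deriv 1 f)) q"
proof -
  have "partial_deriv 1 (partial_deriv 2 (partial_deriv 2 f)) q =
      partial_deriv 2 (partial_deriv 1 (partial_deriv 2 f)) q"
    by (rule partial_deriv_commute[OF open_\<Omega> assms smooth_on_partial_deriv[OF smooth_f]])
  also have "\<dots> = partial_deriv 2 (partial_deriv 2 (partial_deriv 1 f)) q"
    by (rule partial_deriv_cong_open[OF open_\<Omega> assms])
      (rule partial_deriv_commute[OF open_\<Omega> _ smooth_f])
  finally show ?thesis .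
qed

lemma has_partial_deriv_F1:
  assumes "p \<in> M"
  shows "has_partial_deriv 3 (rt_F1 f) (dF1 p) p"
proof -
  have "partial_deriv 1 (partial_deriv 2 f) (xy_part p) = Fxy p"
    by (rule partial_deriv_commute[OF open_\<Omega> in_M(2)[OF assms] smooth_f])
  then show ?thesis
    unfolding rt_F1_def Let_def
    apply -
    apply (rule has_partial_deriv_eq_rhs)
     apply (rule has_partial_deriv_intros smooth_f_partials[THEN has_partial_deriv_lift[OF assms]])+
    apply (simp add: vector_4 partial_deriv_fyy_x[OF in_M(2)[OF assms]] algebra_simps)
    done
qed

text \<open>
  Along \<open>x\<close> only the fibre metric and \<open>F\<^sub>1\<close> vary: \<open>\<partial>\<^sub>x k = \<sigma> k\<close>, so \<open>h \<and> k\<close> picks up \<open>\<sigma>\<close> once and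
  \<open>k \<and> k\<close> twice, and \<open>dF1 / (2r\<^sup>2)\<close> is the derivative of the coefficient \<open>B\<close>.
\<close>

lemma lie_deriv_conharmonic:
  assumes "p \<in> M"
  defines "h \<equiv> metric_table (gtt p) 1 0" and "k \<equiv> metric_table 0 0 (warp p)"
    and "A \<equiv> gtt' p / (2 * p $ 2)"
    and "B \<equiv> gtt' p / (2 * p $ 2) + (gtt'' p / 2 + (rt_F1 f p + gtt p) / (p $ 2)\<^sup>2) / 2"
    and "\<sigma> \<equiv> - (2 * Fx p / F p)"
  shows "lie_deriv (\<lambda>_. axis 3 1) (conharmonic g) p =
    (dF1 p / (2 * (p $ 2)\<^sup>2) + B * \<sigma>) *\<^sub>R kulkarni_nomizu h k + (2 * A * \<sigma>) *\<^sub>R kulkarni_nomizu k k"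
proof -
  note nz = in_M[OF assms(1)]
  let ?A = "\<lambda>q. gtt' q / (2 * q $ 2)"
    and ?B = "\<lambda>q. gtt' q / (2 * q $ 2) + (gtt'' q / 2 + (rt_F1 f q + gtt q) / (q $ 2)\<^sup>2) / 2"
    and ?h = "\<lambda>q. metric_table (gtt q) 1 0" and ?k = "\<lambda>q. metric_table 0 0 (warp q)"
  have r: "has_partial_deriv 3 (\<lambda>q. q $ 2) 0 p"
    using has_partial_deriv_radius[of 3 p] by (simp add: vector_4)
  have gtt: "has_partial_deriv 3 gtt 0 p" "has_partial_deriv 3 gtt' 0 p"
    using has_partial_deriv_gtt[OF assms(1), of 3] by (simp_all add: vector_4)
  have gtt'': "has_partial_deriv 3 gtt'' 0 p"
    unfolding gtt''_def
    apply (rule has_partial_deriv_eq_rhs)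
     apply (rule r has_partial_deriv_intros | simp add: nz)+
    done
  note partials = r gtt gtt'' has_partial_deriv_F1[OF assms(1)] has_partial_deriv_const
    has_partial_deriv_add has_partial_deriv_mult has_partial_deriv_divide has_partial_deriv_power
  have A: "has_partial_deriv 3 ?A 0 p"
    by (rule has_partial_deriv_eq_rhs, (rule partials | simp add: nz)+)
  have B: "has_partial_deriv 3 ?B (dF1 p / (2 * (p $ 2)\<^sup>2)) p"
    apply (rule has_partial_deriv_eq_rhs, (rule partials | simp add: nz)+)
    apply (simp add: nz field_simps power2_eq_square power4_eq_xxxx)
    done
  have "has_partial_deriv 3 warp (\<sigma> * warp p) p"
    by (rule has_partial_deriv_eq_rhs[OF has_partial_deriv_warp[OF assms(1)]])
      (simp add: vector_4 warp_def \<sigma>_def nz field_simps power2_eq_square power3_eq_cube)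
  then have k: "has_partial_deriv 3 (\<lambda>q. ?k q $ i $ j) ((\<sigma> *\<^sub>R k) $ i $ j) p" for i j
    using has_partial_deriv_metric_table[OF has_partial_deriv_const has_partial_deriv_const]
      metric_table_combination[of \<sigma> 0 0 "warp p" 0 0 0 0] by (fastforce simp: k_def)
  have h: "has_partial_deriv 3 (\<lambda>q. ?h q $ i $ j) ((0::real^4^4) $ i $ j) p" for i j
    using has_partial_deriv_metric_table[OF gtt(1) has_partial_deriv_const has_partial_deriv_const]
      metric_table_combination[of 0 0 0 0 0 0 0 0] by (fastforce)
  show ?thesis
    unfolding vec_eq_iff lie_deriv_coordinate_field
  proof (intro allI has_partial_deriv_imp_eq)
    fix i j m n :: 4
    have "has_partial_deriv 3
        (\<lambda>q. ?A q * kulkarni_nomizu (?h q) (?h q) $ i $ j $ m $ n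
          + ?B q * kulkarni_nomizu (?h q) (?k q) $ i $ j $ m $ n
          + ?A q * kulkarni_nomizu (?k q) (?k q) $ i $ j $ m $ n)
        (((dF1 p / (2 * (p $ 2)\<^sup>2) + B * \<sigma>) *\<^sub>R kulkarni_nomizu h k
          + (2 * A * \<sigma>) *\<^sub>R kulkarni_nomizu k k) $ i $ j $ m $ n) p"
      apply (rule has_partial_deriv_eq_rhs)
       apply (rule A B h k has_partial_deriv_kulkarni_nomizu has_partial_deriv_add has_partial_deriv_mult)+
      apply (simp add: kulkarni_nomizu_bilinear A_def B_def h_def k_def algebra_simps
          kulkarni_nomizu_nth)
      done
    then show "has_partial_deriv 3 (\<lambda>q. conharmonic g q $ i $ j $ m $ n)
        (((dF1 p / (2 * (p $ 2)\<^sup>2) + B * \<sigma>) *\<^sub>R kulkarni_nomizu h k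
          + (2 * A * \<sigma>) *\<^sub>R kulkarni_nomizu k k) $ i $ j $ m $ n) p"
      by (rule iffD2[OF has_partial_deriv_cong_open[OF open_M assms(1)], rotated])
        (simp add: conharmonic_eq)
  qed
qed

text \<open>
  Up to the factors \<open>- 1 / r\<^sup>2\<close> and \<open>- 1 / (2r\<^sup>3)\<close>, these are the differences \<open>\<beta> - \<alpha>\<close> of the Ricci
  coefficients and \<open>B - 2A\<close> of the conharmonic coefficients, by which the linear system divides.
\<close>

abbreviation "ricci_gap p \<equiv> rt_F1 f p - 2 * a + 4 * b * p $ 2"
abbreviation "conharmonic_gap p \<equiv> - 6 * d + 2 * a * p $ 2 - p $ 2 * rt_F1 f p"

lemma F5_eq: "rt_F5 a d f p = - (p $ 2 * F p * dF1 p) - 2 * conharmonic_gap p * Fx p"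
  by (simp add: rt_F5_def rt_F1_def Let_def algebra_simps power2_eq_square power3_eq_cube)

text \<open>
  The facts \<open>\<beta>\<alpha>\<close> and \<open>BA\<close> identify the two pivots of the linear system; \<open>eq1\<close>, \<open>eq2\<close> and \<open>eq3\<close> are
  its equations for \<open>h \<and> h\<close>, \<open>h \<and> k\<close> and \<open>k \<and> k\<close>.
\<close>

lemma inheritance_at:
  assumes p: "p \<in> M" and D: "ricci_gap p \<noteq> 0" "conharmonic_gap p \<noteq> 0"
    and \<mu>: "\<mu> = rt_F5 a d f p / (F p * conharmonic_gap p)"
    and \<mu>\<^sub>1: "\<mu>\<^sub>1 = 16 * b * (- d + 2 * b * (p $ 2)\<^sup>2) * Fx p / ((p $ 2)\<^sup>2 * F p * ricci_gap p)
      - (- d + 2 * b * (p $ 2)\<^sup>2) * rt_F5 a d f p / ((p $ 2) ^ 3 * F p * conharmonic_gap p)"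
    and \<mu>\<^sub>2: "\<mu>\<^sub>2 = 4 * (- d + 2 * b * (p $ 2)\<^sup>2) * Fx p / (p $ 2 * F p * ricci_gap p)"
  shows "lie_deriv (\<lambda>_. axis 3 1) (conharmonic g) p =
    \<mu> *\<^sub>R conharmonic g p + \<mu>\<^sub>1 *\<^sub>R kulkarni_nomizu (g p) (g p)
    + \<mu>\<^sub>2 *\<^sub>R kulkarni_nomizu (g p) (ricci g p)"
proof -
  note nz = in_M[OF p]
  define r where "r = p $ 2"
  define A where "A = gtt' p / (2 * r)"
  define B where "B = A + (gtt'' p / 2 + (rt_F1 f p + gtt p) / r\<^sup>2) / 2"
  define \<alpha> where "\<alpha> = - (gtt'' p / 2) - 2 * A"
  define \<beta> where "\<beta> = - 2 * A - (rt_F1 f p + gtt p) / r\<^sup>2"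
  define \<sigma> where "\<sigma> = - (2 * Fx p / F p)"
  have r: "r \<noteq> 0" using nz by (simp add: r_def)
  have A: "A = (- d + 2 * b * r\<^sup>2) / r ^ 3"
    using r by (simp add: A_def gtt'_def r_def[symmetric] field_simps power2_eq_square power3_eq_cube)
  have \<alpha>: "\<alpha> = - (4 * b / r)"
    using r by (simp add: A_def \<alpha>_def gtt'_def gtt''_def r_def[symmetric] field_simps power2_eq_square power3_eq_cube)
  have \<beta>\<alpha>: "\<beta> - \<alpha> = - (ricci_gap p / r\<^sup>2)"
    using r by (simp add: A_def \<alpha>_def \<beta>_def gtt_def gtt''_def r_def[symmetric] field_simps power2_eq_square power3_eq_cube)
  have BA: "B - 2 * A = - (conharmonic_gap p / (2 * r ^ 3))"
    using r by (simp add: A_def B_def gtt_def gtt'_def gtt''_def r_def[symmetric] field_simps power2_eq_square power3_eq_cube)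
  have \<mu>D: "\<mu> * conharmonic_gap p = rt_F5 a d f p / F p"
    using D nz by (simp add: \<mu>)
  have "\<mu>\<^sub>2 * ricci_gap p = 4 * (- d + 2 * b * r\<^sup>2) * Fx p / (r * F p)"
    using D nz by (simp add: \<mu>\<^sub>2 r_def)
  then have "\<mu>\<^sub>2 * (\<beta> - \<alpha>) = - (4 * (- d + 2 * b * r\<^sup>2) * Fx p / (r * F p) / r\<^sup>2)"
    unfolding \<beta>\<alpha> by (metis mult_minus_right times_divide_eq_right)
  also have "\<dots> = 2 * A * \<sigma>"
    using r nz by (simp add: A \<sigma>_def field_simps power2_eq_square power3_eq_cube)
  finally have \<mu>\<^sub>2\<beta>\<alpha>: "\<mu>\<^sub>2 * (\<beta> - \<alpha>) = 2 * A * \<sigma>" .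
  \<comment> \<open>With \<open>ricci_gap p\<close> as an opaque factor \<open>D\<close>, its summands are not distributed over the product.\<close>
  have product: "4 * c * x / (r * F * D) * - (4 * b / r) = - (16 * b * c * x / (r\<^sup>2 * F * D))"
    for c x F D :: real
    by (simp add: power2_eq_square ac_simps)
  have "\<mu>\<^sub>2 * \<alpha> = - (16 * b * (- d + 2 * b * r\<^sup>2) * Fx p / (r\<^sup>2 * F p * ricci_gap p))"
    unfolding \<mu>\<^sub>2 \<alpha> r_def[symmetric] by (rule product)
  moreover have "\<mu> * A = (- d + 2 * b * r\<^sup>2) * rt_F5 a d f p / (r ^ 3 * F p * conharmonic_gap p)"
    by (simp add: \<mu> A ac_simps)
  ultimately have eq1: "\<mu> * A + \<mu>\<^sub>1 + \<mu>\<^sub>2 * \<alpha> = 0"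
    by (simp add: \<mu>\<^sub>1 r_def)
  have "\<mu> * A + \<mu>\<^sub>1 + \<mu>\<^sub>2 * \<beta> = (\<mu> * A + \<mu>\<^sub>1 + \<mu>\<^sub>2 * \<alpha>) + \<mu>\<^sub>2 * (\<beta> - \<alpha>)"
    by (simp add: algebra_simps)
  then have eq3: "\<mu> * A + \<mu>\<^sub>1 + \<mu>\<^sub>2 * \<beta> = 2 * A * \<sigma>"
    using eq1 \<mu>\<^sub>2\<beta>\<alpha> by simp
  have quotient: "- ((- (r * F * x) - 2 * D * y) / F / (2 * r ^ 3)) =
      x / (2 * r\<^sup>2) + - (D / (2 * r ^ 3)) * - (2 * y / F)" if "F \<noteq> 0" for D F x y :: real
    using that r by (simp add: field_simps power2_eq_square power3_eq_cube)
  have "\<mu> * (B - 2 * A) = - (\<mu> * conharmonic_gap p / (2 * r ^ 3))"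
    unfolding BA by simp
  also have "\<dots> = dF1 p / (2 * r\<^sup>2) + (B - 2 * A) * \<sigma>"
    unfolding \<mu>D unfolding F5_eq BA \<sigma>_def r_def[symmetric] by (rule quotient[OF nz(3)])
  finally have "\<mu> * (B - 2 * A) = dF1 p / (2 * r\<^sup>2) + (B - 2 * A) * \<sigma>" .
  moreover have "\<mu> * B + 2 * \<mu>\<^sub>1 + \<mu>\<^sub>2 * (\<alpha> + \<beta>) =
      \<mu> * (B - 2 * A) + 2 * (\<mu> * A + \<mu>\<^sub>1 + \<mu>\<^sub>2 * \<alpha>) + \<mu>\<^sub>2 * (\<beta> - \<alpha>)"
    by (simp add: algebra_simps)
  ultimately have eq2: "\<mu> * B + 2 * \<mu>\<^sub>1 + \<mu>\<^sub>2 * (\<alpha> + \<beta>) = dF1 p / (2 * r\<^sup>2) + B * \<sigma>"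
    using eq1 \<mu>\<^sub>2\<beta>\<alpha> by (simp add: algebra_simps)
  show ?thesis
    unfolding lie_deriv_conharmonic[OF p] conharmonic_eq[OF p] ricci_eq[OF p] metric_split r_def[symmetric]
    unfolding A_def[symmetric] unfolding B_def[symmetric] \<alpha>_def[symmetric] \<beta>_def[symmetric] \<sigma>_def[symmetric]
    by (rule inheritance_combination[OF eq1 eq2 eq3])
qed

lemma smooth_on_lift: "smooth_on u \<Omega> \<Longrightarrow> smooth_on (\<lambda>p. u (xy_part p)) M"
  by (rule smooth_on_xy_part[OF open_M in_M(2)])

lemma smooth_on_F1: "smooth_on (rt_F1 f) M"
  unfolding rt_F1_def Let_def
  by (intro smooth_on_intros smooth_on_lift open_M smooth_f_partials)

lemma smooth_on_F5: "smooth_on (rt_F5 a d f) M"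
  unfolding rt_F5_def Let_def
  by (intro smooth_on_intros smooth_on_lift open_M smooth_f_partials smooth_on_partial_deriv)

end

theorem proposition4p5:
  fixes a b d :: real and I J :: "real set" and \<Omega> :: "(real^2) set" and f :: "real^2 \<Rightarrow> real"
  assumes "open I" and "is_interval I"
    and "open J" and "is_interval J" and "0 \<notin> J"
    and "open \<Omega>" and "connected \<Omega>" and "\<Omega> \<noteq> {}"
    and "smooth_on f \<Omega>" and "\<forall>q\<in>\<Omega>. f q \<noteq> 0"
    and "\<forall>p\<in>rt_domain I J \<Omega>. rt_F1 f p - 2 * a + 4 * b * p $ 2 \<noteq> 0"
    and "\<forall>p\<in>rt_domain I J \<Omega>. p $ 2 * rt_F1 f p - 2 * a * p $ 2 + 6 * d \<noteq> 0"
  shows "generalized_conharmonic_inheritance (rt_domain I J \<Omega>) (rt_metric a b d f) (\<lambda>_. axis 3 1)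
    (\<lambda>p. rt_F5 a d f p / (f (xy_part p) * (- 6 * d + 2 * a * p $ 2 - p $ 2 * rt_F1 f p)))
    (\<lambda>p. 16 * b * (- d + 2 * b * (p $ 2)\<^sup>2) * partial_deriv 1 f (xy_part p)
           / ((p $ 2)\<^sup>2 * f (xy_part p) * (rt_F1 f p - 2 * a + 4 * b * p $ 2))
         - (- d + 2 * b * (p $ 2)\<^sup>2) * rt_F5 a d f p
           / ((p $ 2) ^ 3 * f (xy_part p) * (- 6 * d + 2 * a * p $ 2 - p $ 2 * rt_F1 f p)))
    (\<lambda>p. 4 * (- d + 2 * b * (p $ 2)\<^sup>2) * partial_deriv 1 f (xy_part p)
           / (p $ 2 * f (xy_part p) * (rt_F1 f p - 2 * a + 4 * b * p $ 2)))"
proof -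
  interpret robinson_trautman a b d I J \<Omega> f
    by unfold_locales (use assms in auto)
  have D: "ricci_gap p \<noteq> 0" "conharmonic_gap p \<noteq> 0" if "p \<in> M" for p
    using assms(11,12) that by (fastforce simp: algebra_simps)+
  note smooth = smooth_on_intros smooth_on_F1 smooth_on_F5 open_M
    smooth_f_partials(1,2)[THEN smooth_on_lift]
  show ?thesis
    unfolding generalized_conharmonic_inheritance_def
    by (intro conjI ballI inheritance_at[OF _ D] refl smooth_on_divide smooth)
      (use D in_M in auto)
qed

end
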